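(* Let $p\ge3$, $n\ge1$, $d_1\ge\cdots\ge d_p>0$, $D=\mathrm{diag}(d_1,\dots,d_p)$ and $j\in\mathbb{R}$ with $\sum_{i=1}^p(d_i/d_1)^{1-j}-2\le0$. If $p\ge4$, let $\nu_*\in(0,1-j)$ be the unique solution $\nu$ of $\sum_{i=1}^{p-1}(d_i/d_1)^{\nu}=2$, and let $\nu_{**}$ be any value in $[0,\nu_* )$. If $p=3$, let $\nu_{**}=0$. Put $c_i=(d_i/d_{p-1})^{1-j-\nu_{**}}$ for $i=1,\dots,p-1$, let $c_p>c_1$, $C=\mathrm{diag}(c_1,\dots,c_p)$, $$u_-=\frac{2}{n+2}\left(\sum_{i=1}^{p-1}\left(\frac{d_i}{d_1}\right)^{\nu_{**}}-2+\frac{c_1}{c_p}\left(\frac{d_p}{d_1}\right)^{1-j}\right),$$ $$v_-=\min\left(\frac{c_1c_{p-1}(d_{p-1}-d_p)}{c_1d_{p-1}-c_{p-1}d_p},\ \frac{c_{p-1}c_p(d_1d_{p-1}-d_p^2)}{c_pd_1d_{p-1}-c_{p-1}d_p^2}\right).$$ Suppose $(X',Z')'\in\mathbb{R}^p\times\mathbb{R}^n$ has density $\prod_i d_i^{-1/2}\,\sigma^{-p-n} f(\{(x-\theta)'D^{-1}(x-\theta)+z'z\}/\sigma^2)$. Let $\phi:(0,\infty)\to\mathbb{R}$ be differentiable and increasing ($\phi'\ge0$), with $0\le\phi(w)/w\le v_-$ for every $w>0$ and $\lim_{w\to\infty}\phi(w)\le u_-$. Then the estimator $$\hat\theta_\phi=\left(I-\frac{\phi(W)}{W}C^{-1}\right)X,\qquad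 W=X'C^{-1}D^{-1}X/Z'Z,$$ is minimax under $L_j(\delta,\theta,\sigma^2)=(\delta-\theta)'D^{-j}(\delta-\theta)/\sigma^2$ and condition number decreasing.
   Context: Here $f:[0,\infty)\to[0,\infty)$ is a fixed function such that the displayed expression is a probability density and $X$ has finite second moments; $\theta\in\mathbb{R}^p$ and $\sigma>0$ are unknown. The risk is $R_j(\delta,\theta,\sigma^2)=E[L_j(\delta(X,Z),\theta,\sigma^2)]$. The estimator $X$ is minimax with constant risk, so $\delta$ is minimax if and only if $R_j(\delta,\theta,\sigma^2)\le R_j(X,\theta,\sigma^2)$ for all $\theta$, $\sigma>0$. The estimator $\hat\theta_\phi$ is condition number decreasing if, for every $w>0$, with $t=\phi(w)/w$, $$\frac{\max_i d_i(1-t/c_i)}{\min_i d_i(1-t/c_i)}\le\frac{d_1}{d_p}.$$ (The left side is the condition number of the matrix $G$ for which the corresponding regression coefficient estimator is $\hat\beta_\phi=P\hat\theta_\phi=G^{-1}A'y$, and the right side is that of $A'A$ for least squares $\hat\beta=(A'A)^{-1}A'y$, where $P$ is orthogonal with $P'(A'A)^{-1}P=D$, and $X=P'\hat\beta$.) *)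

theory Defs
  imports "HOL-Probability.Probability"
begin

text \<open>
  Vectors in \<open>\<real>\<^sup>m\<close> are functions \<open>nat \<Rightarrow> real\<close> with index set \<open>{1..m}\<close>, i.e. elements of the
  carrier of the product measure \<open>\<Pi>\<^sub>M i\<in>{1..m}. lborel\<close>.  The matrices \<open>D\<close>, \<open>C\<close> and \<open>D\<^sup>-\<^sup>j\<close> are
  diagonal and are given by their diagonal entries \<open>d i\<close>, \<open>c i\<close> and \<open>d i powr (- j)\<close>.
\<close>

abbreviation euclid :: "nat \<Rightarrow> (nat \<Rightarrow> real) set" where
  "euclid m \<equiv> {1..m} \<rightarrow>\<^sub>E UNIV"

definition nu_star :: "nat \<Rightarrow> (nat \<Rightarrow> real) \<Rightarrow> real \<Rightarrow> real" where
  "nu_star p d j =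
     (THE \<nu>. 0 < \<nu> \<and> \<nu> < 1 - j \<and> (\<Sum>i=1..p-1. (d i / d 1) powr \<nu>) = 2)"

lemma nu_star_ex1:
  fixes p :: nat and d :: "nat \<Rightarrow> real" and j :: real
  assumes p: "p \<ge> 4"
    and anti: "\<And>i k. 1 \<le> i \<Longrightarrow> i \<le> k \<Longrightarrow> k \<le> p \<Longrightarrow> d k \<le> d i"
    and pos: "d p > 0"
    and le: "(\<Sum>i=1..p. (d i / d 1) powr (1 - j)) - 2 \<le> 0"
  shows "\<exists>!\<nu>. 0 < \<nu> \<and> \<nu> < 1 - j \<and> (\<Sum>i=1..p-1. (d i / d 1) powr \<nu>) = 2"
proof -
  define r where "r i = d i / d 1" for i
  define g where "g \<nu> = (\<Sum>i=1..p-1. r i powr \<nu>)" for \<nu>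
  have dpos: "d i > 0" if "i \<in> {1..p}" for i
    using anti[of i p] pos that by auto
  have rpos: "r i > 0" if "i \<in> {1..p}" for i
    unfolding r_def using dpos[OF that] dpos[of 1] p by auto
  have rle: "r i \<le> 1" if "i \<in> {1..p}" for i
    unfolding r_def using anti[of 1 i] dpos[of 1] that p by auto
  have split: "{1..p} = insert p {1..p-1}" using p by auto
  have le': "(\<Sum>i=1..p. r i powr (1 - j)) \<le> 2" using le by (simp add: r_def)
  have "(\<Sum>i=1..p. r i powr (1 - j)) = r p powr (1 - j) + g (1 - j)"
    unfolding g_def split using p by (subst sum.insert) auto
  moreover have "r p powr (1 - j) > 0" using rpos[of p] p by simp
  ultimately have g1: "g (1 - j) < 2" using le' by linarith
  have g_anti: "g b \<le> g a" if "a \<le> b" for a b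
    unfolding g_def
  proof (rule sum_mono)
    fix i assume "i \<in> {1..p-1}"
    hence i: "i \<in> {1..p}" by auto
    show "r i powr b \<le> r i powr a"
      using powr_mono'[OF that, of "r i"] rpos[OF i] rle[OF i] by simp
  qed
  have g0: "g 0 = real (p - 1)"
  proof -
    have "g 0 = (\<Sum>i=1..p-1. 1)"
      unfolding g_def
    proof (rule sum.cong)
      fix i assume "i \<in> {1..p-1}"
      hence "i \<in> {1..p}" by auto
      from rpos[OF this] show "r i powr 0 = 1" by simp
    qed simp
    thus ?thesis by simp
  qed
  have g0': "g 0 \<ge> 3" unfolding g0 using p by linarith
  have j1: "0 < 1 - j"
  proof (rule ccontr)
    assume "\<not> 0 < 1 - j"
    hence "g 0 \<le> g (1 - j)" by (intro g_anti) simp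
    thus False using g1 g0' by simp
  qed
  have rlt: "\<exists>i\<in>{1..p-1}. r i < 1"
  proof (rule ccontr)
    assume "\<not> ?thesis"
    hence *: "r i = 1" if "i \<in> {1..p-1}" for i
    proof -
      have "r i \<le> 1" by (rule rle) (use that in auto)
      moreover have "\<not> r i < 1" using \<open>\<not> (\<exists>i\<in>{1..p-1}. r i < 1)\<close> that by blast
      ultimately show ?thesis by simp
    qed
    have "g (1 - j) = (\<Sum>i=1..p-1. 1)"
      unfolding g_def by (rule sum.cong) (simp_all add: *)
    thus False using g1 g0 g0' by simp
  qed
  have g_strict: "g b < g a" if ab: "a < b" for a b
    unfolding g_def
  proof (rule sum_strict_mono_ex1)
    show "\<forall>i\<in>{1..p-1}. r i powr b \<le> r i powr a"
    proof
      fix i assume "i \<in> {1..p-1}"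
      hence i: "i \<in> {1..p}" by auto
      show "r i powr b \<le> r i powr a"
        using powr_mono'[of a b "r i"] ab rpos[OF i] rle[OF i] by simp
    qed
    from rlt obtain i where i: "i \<in> {1..p-1}" and ri: "r i < 1" by blast
    hence "i \<in> {1..p}" by auto
    from rpos[OF this] have "r i powr b < r i powr a"
      using ri ab by (simp add: powr_def ln_less_zero mult_strict_right_mono_neg)
    thus "\<exists>i\<in>{1..p-1}. r i powr b < r i powr a" using i by blast
  qed simp
  have cont: "continuous_on {0..1-j} g"
    unfolding g_def
  proof (intro continuous_intros ballI)
    fix i x assume "i \<in> {1..p-1}"
    hence "i \<in> {1..p}" by auto
    from rpos[OF this] show "r i \<noteq> 0" by simp
  qed
  have "\<exists>x\<ge>0. x \<le> 1 - j \<and> g x = 2"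
    by (rule IVT2') (use g1 g0' j1 cont in auto)
  then obtain x where x: "0 \<le> x" "x \<le> 1 - j" "g x = 2" by blast
  have "x \<noteq> 0" "x \<noteq> 1 - j" using x g1 g0' by auto
  with x have ex: "0 < x \<and> x < 1 - j \<and> g x = 2" by auto
  have "y = x" if "g y = 2" for y
    using g_strict[of x y] g_strict[of y x] that x(3) by (cases x y rule: linorder_cases) auto
  with ex have "\<exists>!\<nu>. 0 < \<nu> \<and> \<nu> < 1 - j \<and> g \<nu> = 2" by blast
  thus ?thesis by (simp add: g_def r_def)
qed

definition u_minus :: "nat \<Rightarrow> nat \<Rightarrow> (nat \<Rightarrow> real) \<Rightarrow> (nat \<Rightarrow> real) \<Rightarrow> real \<Rightarrow> real \<Rightarrow> real" where
  "u_minus p n d c j \<nu> =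
     2 / (real n + 2) *
       ((\<Sum>i=1..p-1. (d i / d 1) powr \<nu>) - 2 + c 1 / c p * (d p / d 1) powr (1 - j))"

definition v_minus :: "nat \<Rightarrow> (nat \<Rightarrow> real) \<Rightarrow> (nat \<Rightarrow> real) \<Rightarrow> real" where
  "v_minus p d c =
     min (c 1 * c (p-1) * (d (p-1) - d p) / (c 1 * d (p-1) - c (p-1) * d p))
         (c (p-1) * c p * (d 1 * d (p-1) - (d p)\<^sup>2) /
            (c p * d 1 * d (p-1) - c (p-1) * (d p)\<^sup>2))"

definition joint_density ::
  "nat \<Rightarrow> nat \<Rightarrow> (nat \<Rightarrow> real) \<Rightarrow> (real \<Rightarrow> real) \<Rightarrow> (nat \<Rightarrow> real) \<Rightarrow> real
     \<Rightarrow> (nat \<Rightarrow> real) \<times> (nat \<Rightarrow> real) \<Rightarrow> real" where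
  "joint_density p n d f \<theta> \<sigma> = (\<lambda>(x, z).
     (\<Prod>i=1..p. d i powr (- 1/2)) * \<sigma> powr (- real p - real n) *
       f (((\<Sum>i=1..p. (x i - \<theta> i)\<^sup>2 / d i) + (\<Sum>k=1..n. (z k)\<^sup>2)) / \<sigma>\<^sup>2))"

definition model ::
  "nat \<Rightarrow> nat \<Rightarrow> (nat \<Rightarrow> real) \<Rightarrow> (real \<Rightarrow> real) \<Rightarrow> (nat \<Rightarrow> real) \<Rightarrow> real
     \<Rightarrow> ((nat \<Rightarrow> real) \<times> (nat \<Rightarrow> real)) measure" where
  "model p n d f \<theta> \<sigma> =
     density ((\<Pi>\<^sub>M i\<in>{1..p}. lborel) \<Otimes>\<^sub>M (\<Pi>\<^sub>M k\<in>{1..n}. lborel))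
       (\<lambda>y. ennreal (joint_density p n d f \<theta> \<sigma> y))"

definition loss ::
  "nat \<Rightarrow> (nat \<Rightarrow> real) \<Rightarrow> real \<Rightarrow> (nat \<Rightarrow> real) \<Rightarrow> (nat \<Rightarrow> real) \<Rightarrow> real \<Rightarrow> real" where
  "loss p d j a \<theta> \<sigma> = (\<Sum>i=1..p. d i powr (- j) * (a i - \<theta> i)\<^sup>2) / \<sigma>\<^sup>2"

definition estimators ::
  "nat \<Rightarrow> nat \<Rightarrow> ((nat \<Rightarrow> real) \<times> (nat \<Rightarrow> real) \<Rightarrow> (nat \<Rightarrow> real)) set" where
  "estimators p n =
     measurable ((\<Pi>\<^sub>M i\<in>{1..p}. borel) \<Otimes>\<^sub>M (\<Pi>\<^sub>M k\<in>{1..n}. borel)) (\<Pi>\<^sub>M i\<in>{1..p}. borel)"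

text \<open>The loss is nonnegative; the risk is taken in \<open>ennreal\<close>, so it may be infinite.\<close>

definition risk ::
  "nat \<Rightarrow> nat \<Rightarrow> (nat \<Rightarrow> real) \<Rightarrow> (real \<Rightarrow> real) \<Rightarrow> real
     \<Rightarrow> ((nat \<Rightarrow> real) \<times> (nat \<Rightarrow> real) \<Rightarrow> (nat \<Rightarrow> real)) \<Rightarrow> (nat \<Rightarrow> real) \<Rightarrow> real \<Rightarrow> ennreal" where
  "risk p n d f j \<delta> \<theta> \<sigma> =
     (\<integral>\<^sup>+ y. ennreal (loss p d j (\<delta> y) \<theta> \<sigma>) \<partial>model p n d f \<theta> \<sigma>)"

definition max_risk ::
  "nat \<Rightarrow> nat \<Rightarrow> (nat \<Rightarrow> real) \<Rightarrow> (real \<Rightarrow> real) \<Rightarrow> real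
     \<Rightarrow> ((nat \<Rightarrow> real) \<times> (nat \<Rightarrow> real) \<Rightarrow> (nat \<Rightarrow> real)) \<Rightarrow> ennreal" where
  "max_risk p n d f j \<delta> = (SUP (\<theta>, \<sigma>)\<in>euclid p \<times> {0<..}. risk p n d f j \<delta> \<theta> \<sigma>)"

text \<open>
  Competitors are non-randomised; as the loss is convex in the action, admitting randomised
  estimators would not change the notion.
\<close>

definition minimax ::
  "nat \<Rightarrow> nat \<Rightarrow> (nat \<Rightarrow> real) \<Rightarrow> (real \<Rightarrow> real) \<Rightarrow> real
     \<Rightarrow> ((nat \<Rightarrow> real) \<times> (nat \<Rightarrow> real) \<Rightarrow> (nat \<Rightarrow> real)) \<Rightarrow> bool" where
  "minimax p n d f j \<delta> \<longleftrightarrow>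
     \<delta> \<in> estimators p n \<and>
     (\<forall>\<delta>'\<in>estimators p n. max_risk p n d f j \<delta> \<le> max_risk p n d f j \<delta>')"

definition W_stat ::
  "nat \<Rightarrow> nat \<Rightarrow> (nat \<Rightarrow> real) \<Rightarrow> (nat \<Rightarrow> real) \<Rightarrow> (nat \<Rightarrow> real) \<times> (nat \<Rightarrow> real) \<Rightarrow> real" where
  "W_stat p n d c = (\<lambda>(x, z). (\<Sum>i=1..p. (x i)\<^sup>2 / (c i * d i)) / (\<Sum>k=1..n. (z k)\<^sup>2))"

text \<open>
  On the null set where \<open>x = 0\<close> or \<open>z = 0\<close>, total division gives \<open>W = 0\<close> and \<open>\<phi>(W)/W = 0\<close>,
  so the estimator is \<open>x\<close> there and values of \<open>\<phi>\<close> outside \<open>(0,\<infinity>)\<close> play no role.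
\<close>

definition theta_hat ::
  "nat \<Rightarrow> nat \<Rightarrow> (nat \<Rightarrow> real) \<Rightarrow> (nat \<Rightarrow> real) \<Rightarrow> (real \<Rightarrow> real)
     \<Rightarrow> (nat \<Rightarrow> real) \<times> (nat \<Rightarrow> real) \<Rightarrow> (nat \<Rightarrow> real)" where
  "theta_hat p n d c \<phi> = (\<lambda>(x, z). \<lambda>i\<in>{1..p}.
     (1 - \<phi> (W_stat p n d c (x, z)) / W_stat p n d c (x, z) / c i) * x i)"

text \<open>
  The numbers \<open>d i * (1 - t / c i)\<close> are the eigenvalues of \<open>G\<^sup>-\<^sup>1\<close>.  Positivity of the smallest one
  makes the quotient the condition number of \<open>G\<close> and excludes a zero denominator, for which the
  inequality alone would hold trivially.
\<close>

definition condition_number_decreasing ::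
  "nat \<Rightarrow> (nat \<Rightarrow> real) \<Rightarrow> (nat \<Rightarrow> real) \<Rightarrow> (real \<Rightarrow> real) \<Rightarrow> bool" where
  "condition_number_decreasing p d c \<phi> \<longleftrightarrow>
     (\<forall>w>0. let t = \<phi> w / w; ev = (\<lambda>i. d i * (1 - t / c i)) in
        0 < Min (ev ` {1..p}) \<and> Max (ev ` {1..p}) / Min (ev ` {1..p}) \<le> d 1 / d p)"

end

theory Submission
  imports Defs
begin

text \<open>
  Domination. It suffices to show that the estimator does not
  increase the risk of \<open>X\<close> and that the risk of \<open>X\<close> is a lower bound for every maximal risk.  With
  \<open>r = \<phi>(W)/W\<close>, \<open>q = X'C\<^sup>-\<^sup>1D\<^sup>-\<^sup>1X\<close> and \<open>N = X'C\<^sup>-\<^sup>2D\<^sup>-\<^sup>jX\<close>, the difference in loss is the inner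
  product of \<open>(X - \<theta>, Z)\<close> with a vector field once \<open>r\<^sup>2N\<close> is written as \<open>\<Sum>k. Z\<^sub>k \<cdot> Z\<^sub>k r \<phi>(W) N/q\<close>.  Stein's identity for a spherically
  symmetric density \<open>f\<close> (integration by parts, with \<open>f\<close> replaced by its tail integral) turns it into a
  divergence, which is at most \<open>r ((4 + (n+2) \<phi>(W)) N/q - 2 tr(D\<^bsup>1-j\<^esup>C\<^sup>-\<^sup>1))\<close> because \<open>\<phi>' \<ge> 0\<close>.  As \<open>N/q\<close>
  never exceeds the largest entry \<open>d\<^sub>1\<^bsup>1-j\<^esup>/c\<^sub>1\<close> of \<open>D\<^bsup>1-j\<^esup>C\<^sup>-\<^sup>1\<close>, the bound \<open>\<phi> \<le> u\<^sub>-\<close> makes this nonpositive.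
  Truncating \<open>f\<close> to bounded support makes all integrals finite, and monotone convergence removes the
  truncation.

  Lower bound. For fixed \<open>\<sigma>\<close> the risk is averaged over \<open>\<theta>\<close> in a large cube; away from the boundary the
  posterior is a translate of the symmetric error density, so no estimator beats \<open>X\<close> asymptotically.
\<close>

section \<open>Integration by parts against a spherically symmetric density\<close>

text \<open>The obstacle is the derivative of \<phi>: it exists on the positive half-line but may be
  discontinuous and unbounded, so the divergence of the field need not be integrable and the
  two-sided form of Stein's identity cannot simply be quoted. The sign of \<phi>' rescues the
  argument. It enters every partial derivative with a nonpositive coefficient, so these derivatives
  are bounded above. A large multiple of the centred coordinate minus the field is therefore
  nondecreasing along coordinate lines, and for nondecreasing functions integration by parts is an
  equation between nonnegative integrals.

  The constants have two sources. The choice of c makes d_1^(1-j)/c_1 the largest diagonal entry of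
  D^(1-j) C^(-1); dividing the sign condition on the divergence by this entry gives u_-. In it, n
  counts the coordinates of Z and the added 2 stems from the dependence of 1/W on Z. The two
  fractions in v_- are the conditions that the eigenvalue pairs (1, p-1) and (p, p-1) impose; all
  other pairs follow from monotonicity.\<close>

lemma nn_integral_lborel_uminus:
  fixes f :: "real \<Rightarrow> ennreal"
  assumes "f \<in> borel_measurable borel"
  shows "(\<integral>\<^sup>+u. f (- u) \<partial>lborel) = (\<integral>\<^sup>+u. f u \<partial>lborel)"
  using nn_integral_real_affine[OF assms, of "-1" 0] by simp

text \<open>The change of variables on compact intervals passes to the half-line by monotone
  convergence. The end point \<open>a + real (Suc m)\<close> keeps each interval nondegenerate, and
  \<open>a \<ge> 0\<close> makes the Jacobian \<open>2 * k * u\<close> nonnegative.\<close>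

lemma nn_integral_square_substitution_Ici:
  fixes f :: "real \<Rightarrow> ennreal"
  assumes f[measurable]: "f \<in> borel_measurable borel" and k: "k > 0" and a: "a \<ge> 0"
  shows "(\<integral>\<^sup>+s. f s * indicator {k * a\<^sup>2 + R..} s \<partial>lborel) =
         (\<integral>\<^sup>+u. f (k * u\<^sup>2 + R) * ennreal (2 * k * u) * indicator {a..} u \<partial>lborel)"
proof -
  define g where "g u = k * u\<^sup>2 + R" for u
  have g_mono: "g x \<le> g y" if "0 \<le> x" "x \<le> y" for x y
    unfolding g_def using k that by (intro add_right_mono mult_left_mono power_mono) auto
  have step: "(\<integral>\<^sup>+s. f s * indicator {g a..g (a + real (Suc m))} s \<partial>lborel) =
      (\<integral>\<^sup>+u. f (g u) * ennreal (2 * k * u) * indicator {a..a + real (Suc m)} u \<partial>lborel)" for m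
    by (rule nn_integral_substitution_aux)
      (use k a in \<open>auto simp: g_def intro!: derivative_eq_intros continuous_intros\<close>)
  have "(\<integral>\<^sup>+s. f s * indicator {g a..} s \<partial>lborel) =
      (SUP m. \<integral>\<^sup>+s. f s * indicator {g a..g (a + real (Suc m))} s \<partial>lborel)"
  proof (subst nn_integral_monotone_convergence_SUP[symmetric])
    show "incseq (\<lambda>m s. f s * indicator {g a..g (a + real (Suc m))} s)"
    proof (intro incseq_SucI le_funI)
      fix m s
      have "g (a + real (Suc m)) \<le> g (a + real (Suc (Suc m)))"
        by (rule g_mono) (use a in auto)
      then show "f s * indicator {g a..g (a + real (Suc m))} s
          \<le> f s * indicator {g a..g (a + real (Suc (Suc m)))} s"
        by (auto split: split_indicator)
    qed
    have "(SUP m. f s * indicator {g a..g (a + real (Suc m))} s) = f s * indicator {g a..} s" for s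
    proof (cases "s \<ge> g a")
      case True
      have "filterlim (\<lambda>m. g (a + real (Suc m))) at_top sequentially"
        unfolding g_def using k by real_asymp
      then have "eventually (\<lambda>m. s \<le> g (a + real (Suc m))) sequentially"
        by (simp add: filterlim_at_top)
      then obtain m where m: "s \<le> g (a + real (Suc m))"
        by (auto simp: eventually_sequentially)
      show ?thesis
      proof (rule antisym)
        show "(SUP m. f s * indicator {g a..g (a + real (Suc m))} s) \<le> f s * indicator {g a..} s"
          by (rule SUP_least) (auto split: split_indicator)
        have "f s * indicator {g a..} s \<le> f s * indicator {g a..g (a + real (Suc m))} s"
          using m by (auto split: split_indicator)
        also have "\<dots> \<le> (SUP m. f s * indicator {g a..g (a + real (Suc m))} s)"
          by (rule SUP_upper) simp
        finally show "f s * indicator {g a..} s \<le> (SUP m. f s * indicator {g a..g (a + real (Suc m))} s)" .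
      qed
    qed simp
    then show "(\<integral>\<^sup>+s. f s * indicator {g a..} s \<partial>lborel) =
        (\<integral>\<^sup>+s. (SUP m. f s * indicator {g a..g (a + real (Suc m))} s) \<partial>lborel)" by simp
  qed auto
  also have "\<dots> = (SUP m. \<integral>\<^sup>+u. f (g u) * ennreal (2 * k * u) * indicator {a..a + real (Suc m)} u \<partial>lborel)"
    by (simp only: step)
  also have "\<dots> = (\<integral>\<^sup>+u. f (g u) * ennreal (2 * k * u) * indicator {a..} u \<partial>lborel)"
  proof (subst nn_integral_monotone_convergence_SUP[symmetric])
    show "incseq (\<lambda>m u. f (g u) * ennreal (2 * k * u) * indicator {a..a + real (Suc m)} u)"
      by (intro incseq_SucI le_funI) (auto split: split_indicator)
    have "(SUP m. f (g u) * ennreal (2 * k * u) * indicator {a..a + real (Suc m)} u) =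
        f (g u) * ennreal (2 * k * u) * indicator {a..} u" for u
    proof (cases "u \<ge> a")
      case True
      obtain m where m: "u - a \<le> real m" using real_arch_simple by blast
      show ?thesis
      proof (rule antisym)
        show "(SUP m. f (g u) * ennreal (2 * k * u) * indicator {a..a + real (Suc m)} u)
          \<le> f (g u) * ennreal (2 * k * u) * indicator {a..} u"
          by (rule SUP_least) (auto split: split_indicator)
        have "f (g u) * ennreal (2 * k * u) * indicator {a..} u
            \<le> f (g u) * ennreal (2 * k * u) * indicator {a..a + real (Suc m)} u"
          using m by (auto split: split_indicator)
        also have "\<dots> \<le> (SUP m. f (g u) * ennreal (2 * k * u) * indicator {a..a + real (Suc m)} u)"
          by (rule SUP_upper) simp
        finally show "f (g u) * ennreal (2 * k * u) * indicator {a..} u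
            \<le> (SUP m. f (g u) * ennreal (2 * k * u) * indicator {a..a + real (Suc m)} u)" .
      qed
    qed simp
    then show "(\<integral>\<^sup>+u. (SUP m. f (g u) * ennreal (2 * k * u) * indicator {a..a + real (Suc m)} u) \<partial>lborel)
      = (\<integral>\<^sup>+u. f (g u) * ennreal (2 * k * u) * indicator {a..} u \<partial>lborel)" by simp
  qed (auto simp: g_def)
  finally show ?thesis by (simp add: g_def)
qed

text \<open>Each sign of \<open>u\<close> contributes one copy of the half-line formula. The two
  half-lines can meet only at \<open>u = 0\<close>, where the weight \<open>\<bar>u\<bar>\<close>
  vanishes, so the splitting is a pointwise equality.\<close>

lemma nn_integral_square_substitution:
  fixes f :: "real \<Rightarrow> ennreal"
  assumes f[measurable]: "f \<in> borel_measurable borel" and k: "k > 0"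
  shows "(\<integral>\<^sup>+u. f (k * u\<^sup>2 + R) * ennreal (2 * k * \<bar>u\<bar>) * indicator {u. \<bar>v\<bar> \<le> \<bar>u\<bar>} u \<partial>lborel) =
         2 * (\<integral>\<^sup>+s. f s * indicator {k * v\<^sup>2 + R..} s \<partial>lborel)"
proof -
  let ?h = "\<lambda>u. f (k * u\<^sup>2 + R) * ennreal (2 * k * u) * indicator {\<bar>v\<bar>..} u"
  have "(\<integral>\<^sup>+u. f (k * u\<^sup>2 + R) * ennreal (2 * k * \<bar>u\<bar>) * indicator {u. \<bar>v\<bar> \<le> \<bar>u\<bar>} u \<partial>lborel) =
      (\<integral>\<^sup>+u. ?h u + ?h (- u) \<partial>lborel)"
    by (rule nn_integral_cong) (auto split: split_indicator simp: abs_if)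
  also have "\<dots> = (\<integral>\<^sup>+u. ?h u \<partial>lborel) + (\<integral>\<^sup>+u. ?h (- u) \<partial>lborel)"
    by (rule nn_integral_add) auto
  also have "(\<integral>\<^sup>+u. ?h (- u) \<partial>lborel) = (\<integral>\<^sup>+u. ?h u \<partial>lborel)"
    by (rule nn_integral_lborel_uminus) simp
  also have "(\<integral>\<^sup>+u. ?h u \<partial>lborel) = (\<integral>\<^sup>+s. f s * indicator {k * \<bar>v\<bar>\<^sup>2 + R..} s \<partial>lborel)"
    by (rule nn_integral_square_substitution_Ici[symmetric]) (use k in auto)
  finally show ?thesis by (simp only: mult_2 power2_abs)
qed

text \<open>Formally minus a primitive of \<open>f\<close>, so that
  \<open>u * f (k * u^2 + R)\<close> is the derivative of
  \<open>- tail_integral f (k * u^2 + R) / (2 * k)\<close>. With values in \<open>ennreal\<close> it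
  makes sense even where the integral diverges.\<close>

definition tail_integral :: "(real \<Rightarrow> real) \<Rightarrow> real \<Rightarrow> ennreal" where
  "tail_integral f t = (\<integral>\<^sup>+s. ennreal (f s) * indicator {t..} s \<partial>lborel)"

lemma borel_measurable_tail_integral[measurable]:
  assumes [measurable]: "f \<in> borel_measurable borel"
  shows "tail_integral f \<in> borel_measurable borel"
proof -
  have "tail_integral f = (\<lambda>t. \<integral>\<^sup>+s. ennreal (f s) * (if t \<le> s then 1 else 0) \<partial>lborel)"
    by (auto simp: tail_integral_def fun_eq_iff intro!: nn_integral_cong split: split_indicator)
  also have "\<dots> \<in> borel_measurable borel" by measurable
  finally show ?thesis .
qed

text \<open>Symmetrising in \<open>u\<close> turns \<open>h\<close> into \<open>h u - h (- u)\<close>, the integral of \<open>h'\<close> over \<open>[-u, u]\<close>;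
  the rest is Tonelli, which is why monotonicity replaces any integrability of \<open>h'\<close>.\<close>

lemma integration_by_parts_line:
  fixes f h h' :: "real \<Rightarrow> real"
  assumes f[measurable]: "f \<in> borel_measurable borel" and f0: "\<And>s. f s \<ge> 0" and k: "k > 0"
    and h'[measurable]: "h' \<in> borel_measurable borel"
    and der: "\<And>u. (h has_real_derivative h' u) (at u)" and h'0: "\<And>u. h' u \<ge> 0"
    and int: "integrable lborel (\<lambda>u. u * h u * f (k * u\<^sup>2 + R))"
  shows "0 \<le> (\<integral>u. u * h u * f (k * u\<^sup>2 + R) \<partial>lborel)"
    and "ennreal (\<integral>u. u * h u * f (k * u\<^sup>2 + R) \<partial>lborel) =
     (\<integral>\<^sup>+u. ennreal (h' u / (2 * k)) * tail_integral f (k * u\<^sup>2 + R) \<partial>lborel)"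
proof -
  have cont: "continuous_on UNIV h"
    using der by (meson DERIV_isCont continuous_at_imp_continuous_on)
  then have [measurable]: "h \<in> borel_measurable borel"
    by (rule borel_measurable_continuous_onI)
  define E where "E u = u * h u * f (k * u\<^sup>2 + R)" for u
  define S where "S u = \<bar>u\<bar> * (h \<bar>u\<bar> - h (- \<bar>u\<bar>)) * f (k * u\<^sup>2 + R)" for u
  have ftc: "(\<integral>\<^sup>+v. ennreal (h' v) * indicator {a..b} v \<partial>lborel) = ennreal (h b - h a)"
    if "a \<le> b" for a b
    by (rule nn_integral_FTC_Icc)
      (use that der h'0 in \<open>auto intro: has_field_derivative_at_within\<close>)
  have mono: "h a \<le> h b" if "a \<le> b" for a b
    using DERIV_nonneg_imp_nondecreasing[OF that] der h'0 by blast
  have S0: "S u \<ge> 0" for u unfolding S_def using mono[of "- \<bar>u\<bar>" "\<bar>u\<bar>"] f0 by auto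
  have intE: "integrable lborel E" using int by (simp add: E_def[abs_def])
  have intE': "integrable lborel (\<lambda>u. E (- u))"
    using lborel_integrable_real_affine[OF intE, of "-1" 0] by simp
  have SE: "S u = E u + E (- u)" for u
    by (cases "u \<ge> 0") (auto simp: S_def E_def abs_if algebra_simps)
  have intS: "integrable lborel S" unfolding SE using intE intE' by simp
  have "(\<integral>u. E (- u) \<partial>lborel) = (\<integral>u. E u \<partial>lborel)"
    using lborel_integral_real_affine[of "-1" E 0] by simp
  then have IS: "(\<integral>u. S u \<partial>lborel) = 2 * (\<integral>u. E u \<partial>lborel)"
    unfolding SE using intE intE' by simp
  then show "0 \<le> (\<integral>u. u * h u * f (k * u\<^sup>2 + R) \<partial>lborel)"
    using integral_nonneg_AE[of S lborel] S0 by (simp add: E_def)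
  have "ennreal (\<integral>u. S u \<partial>lborel) = (\<integral>\<^sup>+u. ennreal (S u) \<partial>lborel)"
    using nn_integral_eq_integral[OF intS] S0 by simp
  also have "\<dots> = (\<integral>\<^sup>+u. \<integral>\<^sup>+v. ennreal (f (k * u\<^sup>2 + R)) * ennreal \<bar>u\<bar> * (ennreal (h' v) *
      (if \<bar>v\<bar> \<le> \<bar>u\<bar> then 1 else 0)) \<partial>lborel \<partial>lborel)"
  proof (rule nn_integral_cong)
    fix u :: real
    have "ennreal (S u) = ennreal (f (k * u\<^sup>2 + R)) * ennreal \<bar>u\<bar> * ennreal (h \<bar>u\<bar> - h (- \<bar>u\<bar>))"
    proof -
      have S: "S u = f (k * u\<^sup>2 + R) * \<bar>u\<bar> * (h \<bar>u\<bar> - h (- \<bar>u\<bar>))"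
        by (simp add: S_def mult_ac)
      have d: "0 \<le> h \<bar>u\<bar> - h (- \<bar>u\<bar>)" using mono[of "- \<bar>u\<bar>" "\<bar>u\<bar>"] by simp
      show ?thesis unfolding S using f0
        by (simp only: ennreal_mult[OF mult_nonneg_nonneg[OF f0 abs_ge_zero] d] ennreal_mult[OF f0 abs_ge_zero])
    qed
    also have "\<dots> = ennreal (f (k * u\<^sup>2 + R)) * ennreal \<bar>u\<bar> *
        (\<integral>\<^sup>+v. ennreal (h' v) * indicator {- \<bar>u\<bar>..\<bar>u\<bar>} v \<partial>lborel)"
      by (subst ftc) auto
    also have "(\<integral>\<^sup>+v. ennreal (h' v) * indicator {- \<bar>u\<bar>..\<bar>u\<bar>} v \<partial>lborel) =
        (\<integral>\<^sup>+v. ennreal (h' v) * (if \<bar>v\<bar> \<le> \<bar>u\<bar> then 1 else 0) \<partial>lborel)"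
      by (rule nn_integral_cong) (auto split: split_indicator simp: abs_le_iff)
    finally show "ennreal (S u) = (\<integral>\<^sup>+v. ennreal (f (k * u\<^sup>2 + R)) * ennreal \<bar>u\<bar> * (ennreal (h' v) *
      (if \<bar>v\<bar> \<le> \<bar>u\<bar> then 1 else 0)) \<partial>lborel)"
      by (simp add: nn_integral_cmult)
  qed
  also have "\<dots> = (\<integral>\<^sup>+v. \<integral>\<^sup>+u. ennreal (f (k * u\<^sup>2 + R)) * ennreal \<bar>u\<bar> * (ennreal (h' v) *
      (if \<bar>v\<bar> \<le> \<bar>u\<bar> then 1 else 0)) \<partial>lborel \<partial>lborel)"
    by (rule lborel_pair.Fubini') measurable
  also have "\<dots> = (\<integral>\<^sup>+v. 2 * (ennreal (h' v / (2 * k)) * tail_integral f (k * v\<^sup>2 + R)) \<partial>lborel)"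
  proof (rule nn_integral_cong)
    fix v :: real
    have "(\<integral>\<^sup>+u. ennreal (f (k * u\<^sup>2 + R)) * ennreal \<bar>u\<bar> * (ennreal (h' v) *
        (if \<bar>v\<bar> \<le> \<bar>u\<bar> then 1 else 0)) \<partial>lborel) =
      (\<integral>\<^sup>+u. ennreal (h' v / (2 * k)) *
        (ennreal (f (k * u\<^sup>2 + R)) * ennreal (2 * k * \<bar>u\<bar>) * indicator {u. \<bar>v\<bar> \<le> \<bar>u\<bar>} u) \<partial>lborel)"
    proof (rule nn_integral_cong)
      fix u :: real
      have "ennreal \<bar>u\<bar> * ennreal (h' v) = ennreal (h' v / (2 * k)) * ennreal (2 * k * \<bar>u\<bar>)"
        using k h'0[of v] by (simp flip: ennreal_mult)
      note eq = this
      have "ennreal (f (k * u\<^sup>2 + R)) * ennreal \<bar>u\<bar> * (ennreal (h' v) * x) =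
          ennreal (h' v / (2 * k)) * (ennreal (f (k * u\<^sup>2 + R)) * ennreal (2 * k * \<bar>u\<bar>) * x)" for x
      proof -
        have "ennreal (f (k * u\<^sup>2 + R)) * ennreal \<bar>u\<bar> * (ennreal (h' v) * x) =
          (ennreal \<bar>u\<bar> * ennreal (h' v)) * (ennreal (f (k * u\<^sup>2 + R)) * x)"
          by (simp only: mult_ac)
        also have "\<dots> = ennreal (h' v / (2 * k)) * (ennreal (f (k * u\<^sup>2 + R)) * ennreal (2 * k * \<bar>u\<bar>) * x)"
          unfolding eq by (simp only: mult_ac)
        finally show ?thesis .
      qed
      then show "ennreal (f (k * u\<^sup>2 + R)) * ennreal \<bar>u\<bar> * (ennreal (h' v) *
          (if \<bar>v\<bar> \<le> \<bar>u\<bar> then 1 else 0)) = ennreal (h' v / (2 * k)) *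
        (ennreal (f (k * u\<^sup>2 + R)) * ennreal (2 * k * \<bar>u\<bar>) * indicator {u. \<bar>v\<bar> \<le> \<bar>u\<bar>} u)"
        by (simp add: indicator_def)
    qed
    also have "\<dots> = ennreal (h' v / (2 * k)) * (2 * tail_integral f (k * v\<^sup>2 + R))"
      by (subst nn_integral_cmult)
        (auto simp: tail_integral_def nn_integral_square_substitution[of "\<lambda>s. ennreal (f s)"] k)
    finally show "(\<integral>\<^sup>+u. ennreal (f (k * u\<^sup>2 + R)) * ennreal \<bar>u\<bar> * (ennreal (h' v) *
        (if \<bar>v\<bar> \<le> \<bar>u\<bar> then 1 else 0)) \<partial>lborel) =
        2 * (ennreal (h' v / (2 * k)) * tail_integral f (k * v\<^sup>2 + R))" by (simp add: mult_ac)
  qed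
  also have "\<dots> = 2 * (\<integral>\<^sup>+v. ennreal (h' v / (2 * k)) * tail_integral f (k * v\<^sup>2 + R) \<partial>lborel)"
    by (rule nn_integral_cmult) measurable
  finally have "2 * ennreal (\<integral>u. E u \<partial>lborel) =
      2 * (\<integral>\<^sup>+v. ennreal (h' v / (2 * k)) * tail_integral f (k * v\<^sup>2 + R) \<partial>lborel)"
    by (simp add: IS ennreal_mult')
  then show "ennreal (\<integral>u. u * h u * f (k * u\<^sup>2 + R) \<partial>lborel) =
     (\<integral>\<^sup>+u. ennreal (h' u / (2 * k)) * tail_integral f (k * u\<^sup>2 + R) \<partial>lborel)"
    by (simp add: E_def ennreal_mult_cancel_left)
qed

text \<open>The map \<open>e\<close> inserts one real coordinate \<open>t\<close> into the remaining
  ones. Keeping it abstract serves both blocks, with centre \<open>\<eta> = \<theta> i\<close> for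
  the first and \<open>\<eta> = 0\<close> for the second. On each line the radial variable is a
  multiple of \<open>(t - \<eta>)^2\<close> plus a constant, which is the one-dimensional situation.
  Almost every line is enough, so exceptional lines of the first block can be discarded.\<close>

lemma integration_by_parts_coordinate:
  fixes N :: "'a measure" and M :: "'b measure" and e :: "'a \<times> real \<Rightarrow> 'b"
    and f :: "real \<Rightarrow> real" and h h' Q U :: "'b \<Rightarrow> real"
  assumes N: "sigma_finite_measure N"
    and e[measurable]: "e \<in> N \<Otimes>\<^sub>M lborel \<rightarrow>\<^sub>M M" and distr: "distr (N \<Otimes>\<^sub>M lborel) M e = M"
    and f[measurable]: "f \<in> borel_measurable borel" and f0: "\<And>s. f s \<ge> 0" and k: "k > 0"
    and [measurable]: "h \<in> borel_measurable M" "h' \<in> borel_measurable M"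
      "Q \<in> borel_measurable M" "U \<in> borel_measurable M"
    and U: "\<And>x t. x \<in> space N \<Longrightarrow> U (e (x, t)) = t - \<eta>"
    and Q: "\<And>x t. x \<in> space N \<Longrightarrow> Q (e (x, t)) = k * (t - \<eta>)\<^sup>2 + R x"
    and der: "AE x in N. \<forall>t. ((\<lambda>t. h (e (x, t))) has_real_derivative h' (e (x, t))) (at t)"
    and h'0: "\<And>y. y \<in> space M \<Longrightarrow> h' y \<ge> 0"
    and int: "integrable M (\<lambda>y. U y * h y * f (Q y))"
  shows "0 \<le> (\<integral>y. U y * h y * f (Q y) \<partial>M)"
    and "ennreal (\<integral>y. U y * h y * f (Q y) \<partial>M) =
      (\<integral>\<^sup>+y. ennreal (h' y / (2 * k)) * tail_integral f (Q y) \<partial>M)"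
proof -
  interpret N: sigma_finite_measure N by (rule N)
  interpret NL: pair_sigma_finite N "lborel :: real measure" ..
  define E where "E y = U y * h y * f (Q y)" for y
  have [measurable]: "E \<in> borel_measurable M" unfolding E_def by measurable
  have intE: "integrable (N \<Otimes>\<^sub>M lborel) (\<lambda>z. E (e z))"
    using int integrable_distr_eq[OF e, of E] unfolding distr by (simp add: E_def[abs_def])
  have line: "0 \<le> (\<integral>t. E (e (x, t)) \<partial>lborel) \<and> ennreal (\<integral>t. E (e (x, t)) \<partial>lborel) =
      (\<integral>\<^sup>+t. ennreal (h' (e (x, t)) / (2 * k)) * tail_integral f (Q (e (x, t))) \<partial>lborel)"
    if x: "x \<in> space N" and i: "integrable lborel (\<lambda>t. E (e (x, t)))"
      and d: "\<forall>t. ((\<lambda>t. h (e (x, t))) has_real_derivative h' (e (x, t))) (at t)" for x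
  proof -
    have ex[measurable]: "(\<lambda>t. e (x, t)) \<in> borel \<rightarrow>\<^sub>M M"
      using measurable_Pair2[OF e x] by simp
    have sp: "e (x, t) \<in> space M" for t using measurable_space[OF ex] by simp
    have Ee: "E (e (x, \<eta> + 1 * u)) = u * h (e (x, \<eta> + u)) * f (k * u\<^sup>2 + R x)" for u
      by (simp add: E_def U Q x)
    have i': "integrable lborel (\<lambda>u. u * h (e (x, \<eta> + u)) * f (k * u\<^sup>2 + R x))"
      using lborel_integrable_real_affine[OF i, of 1 \<eta>] unfolding Ee by simp
    have d': "((\<lambda>u. h (e (x, \<eta> + u))) has_real_derivative h' (e (x, \<eta> + u))) (at u)" for u
      using d[rule_format, of "\<eta> + u"] DERIV_shift[of "\<lambda>t. h (e (x, t))" _ u \<eta>] by (simp add: add_ac)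
    note ibp = integration_by_parts_line[OF f f0 k _ d' _ i']
    have "(\<integral>t. E (e (x, t)) \<partial>lborel) = (\<integral>u. u * h (e (x, \<eta> + u)) * f (k * u\<^sup>2 + R x) \<partial>lborel)"
      using lborel_integral_real_affine[of 1 "\<lambda>t. E (e (x, t))" \<eta>] unfolding Ee by simp
    moreover have "(\<integral>\<^sup>+t. ennreal (h' (e (x, t)) / (2 * k)) * tail_integral f (Q (e (x, t))) \<partial>lborel) =
        (\<integral>\<^sup>+u. ennreal (h' (e (x, \<eta> + u)) / (2 * k)) * tail_integral f (k * u\<^sup>2 + R x) \<partial>lborel)"
      by (subst nn_integral_real_affine[where c = 1 and t = \<eta>])
        (use sp in \<open>auto simp: Q x intro!: nn_integral_cong\<close>)
    ultimately show ?thesis using ibp h'0[OF sp] by simp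
  qed
  \<comment> \<open>Fubini supplies integrability on almost every line, the remaining premise of the
    one-dimensional case.\<close>
  have AE: "AE x in N. 0 \<le> (\<integral>t. E (e (x, t)) \<partial>lborel) \<and> ennreal (\<integral>t. E (e (x, t)) \<partial>lborel) =
      (\<integral>\<^sup>+t. ennreal (h' (e (x, t)) / (2 * k)) * tail_integral f (Q (e (x, t))) \<partial>lborel)"
    using der NL.AE_integrable_fst'[OF intE] AE_space by eventually_elim (rule line)
  have eq: "(\<integral>y. E y \<partial>M) = (\<integral>x. (\<integral>t. E (e (x, t)) \<partial>lborel) \<partial>N)"
    using integral_distr[OF e, of E] NL.integral_fst'[OF intE] unfolding distr by simp
  show "0 \<le> (\<integral>y. U y * h y * f (Q y) \<partial>M)"
    using AE unfolding E_def[symmetric] eq by (intro integral_nonneg_AE) auto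
  have "ennreal (\<integral>x. (\<integral>t. E (e (x, t)) \<partial>lborel) \<partial>N) =
      (\<integral>\<^sup>+x. ennreal (\<integral>t. E (e (x, t)) \<partial>lborel) \<partial>N)"
    by (rule nn_integral_eq_integral[symmetric]) (use AE NL.integrable_fst'[OF intE] in auto)
  also have "\<dots> = (\<integral>\<^sup>+x. \<integral>\<^sup>+t. ennreal (h' (e (x, t)) / (2 * k)) *
      tail_integral f (Q (e (x, t))) \<partial>lborel \<partial>N)"
    using AE by (intro nn_integral_cong_AE) auto
  also have "\<dots> = (\<integral>\<^sup>+z. ennreal (h' (e z) / (2 * k)) * tail_integral f (Q (e z)) \<partial>(N \<Otimes>\<^sub>M lborel))"
    by (subst lborel.nn_integral_fst[symmetric]) auto
  also have "\<dots> = (\<integral>\<^sup>+y. ennreal (h' y / (2 * k)) * tail_integral f (Q y) \<partial>distr (N \<Otimes>\<^sub>M lborel) M e)"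
    by (subst nn_integral_distr) auto
  finally show "ennreal (\<integral>y. U y * h y * f (Q y) \<partial>M) =
      (\<integral>\<^sup>+y. ennreal (h' y / (2 * k)) * tail_integral f (Q y) \<partial>M)"
    unfolding distr E_def[symmetric] eq .
qed

section \<open>Lebesgue measure on finite products\<close>

abbreviation lborel_fun :: "'i set \<Rightarrow> ('i \<Rightarrow> real) measure" where
  "lborel_fun I \<equiv> Pi\<^sub>M I (\<lambda>_. lborel)"

lemma sigma_finite_lborel_fun: "finite I \<Longrightarrow> sigma_finite_measure (lborel_fun I)"
proof -
  assume "finite I"
  interpret finite_product_sigma_finite "\<lambda>_. lborel :: real measure" I
    by standard fact
  show ?thesis by (rule sigma_finite_measure_axioms)
qed

lemma pair_sigma_finite_lborel_fun:
  "finite I \<Longrightarrow> finite K \<Longrightarrow> pair_sigma_finite (lborel_fun I) (lborel_fun K)"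
  by (simp add: pair_sigma_finite_def sigma_finite_lborel_fun)

lemma sigma_finite_lborel_fun_pair:
  assumes "finite I" "finite K"
  shows "sigma_finite_measure (lborel_fun I \<Otimes>\<^sub>M lborel_fun K)"
proof -
  interpret pair_sigma_finite "lborel_fun I" "lborel_fun K"
    by (rule pair_sigma_finite_lborel_fun) (fact assms)+
  show ?thesis by (rule sigma_finite_measure_axioms)
qed

text \<open>Exactly the maps with unit Jacobian that occur: \<open>s = 1\<close> translates by the
  location parameter, \<open>s = - 1\<close> reflects the error or passes from parameter to
  error.\<close>

lemma distr_lborel_fun_affine:
  fixes s :: real
  assumes I: "finite I" and s: "\<bar>s\<bar> = 1"
  shows "distr (lborel_fun I) (lborel_fun I) (\<lambda>x. \<lambda>i\<in>I. t i + s * x i) = lborel_fun I"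
proof -
  interpret product_sigma_finite "\<lambda>_. lborel :: real measure" ..
  have m[measurable]: "(\<lambda>x. \<lambda>i\<in>I. t i + s * x i) \<in> lborel_fun I \<rightarrow>\<^sub>M lborel_fun I"
    by measurable
  have d: "distr lborel borel (\<lambda>x. a + s * x) = lborel" for a
    using lborel_real_affine[of s a] s by (simp add: density_1)
  show ?thesis
  proof (rule PiM_eqI[OF I])
    fix A assume A: "\<And>i. i \<in> I \<Longrightarrow> A i \<in> sets (lborel :: real measure)"
    have "(\<lambda>x. \<lambda>i\<in>I. t i + s * x i) -` Pi\<^sub>E I A \<inter> space (lborel_fun I) =
        Pi\<^sub>E I (\<lambda>i. (\<lambda>x. t i + s * x) -` A i)"
      by (auto simp: space_PiM PiE_iff)
    then have "emeasure (distr (lborel_fun I) (lborel_fun I) (\<lambda>x. \<lambda>i\<in>I. t i + s * x i)) (Pi\<^sub>E I A) =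
        emeasure (lborel_fun I) (Pi\<^sub>E I (\<lambda>i. (\<lambda>x. t i + s * x) -` A i))"
      using A I by (subst emeasure_distr) (auto intro!: sets_PiM_I_finite)
    also have "\<dots> = (\<Prod>i\<in>I. emeasure lborel ((\<lambda>x. t i + s * x) -` A i))"
    proof (rule emeasure_PiM[OF I])
      fix i assume "i \<in> I"
      then show "(\<lambda>x. t i + s * x) -` A i \<in> sets lborel"
        using A measurable_sets_borel[of "\<lambda>x. t i + s * x" borel "A i"] by simp
    qed
    also have "\<dots> = (\<Prod>i\<in>I. emeasure lborel (A i))"
    proof (rule prod.cong)
      fix i assume "i \<in> I"
      then have "emeasure (distr lborel borel (\<lambda>x. t i + s * x)) (A i) =
          emeasure lborel ((\<lambda>x. t i + s * x) -` A i)"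
        using A by (subst emeasure_distr) auto
      then show "emeasure lborel ((\<lambda>x. t i + s * x) -` A i) = emeasure lborel (A i)"
        by (simp add: d)
    qed simp
    finally show "emeasure (distr (lborel_fun I) (lborel_fun I) (\<lambda>x. \<lambda>i\<in>I. t i + s * x i)) (Pi\<^sub>E I A) =
        (\<Prod>i\<in>I. emeasure lborel (A i))" .
  qed simp
qed

lemma nn_integral_lborel_fun_affine:
  fixes s :: real
  assumes "finite I" "\<bar>s\<bar> = 1" and g: "g \<in> borel_measurable (lborel_fun I)"
  shows "(\<integral>\<^sup>+x. g (\<lambda>i\<in>I. t i + s * x i) \<partial>lborel_fun I) = (\<integral>\<^sup>+x. g x \<partial>lborel_fun I)"
proof -
  have m: "(\<lambda>x. \<lambda>i\<in>I. t i + s * x i) \<in> lborel_fun I \<rightarrow>\<^sub>M lborel_fun I"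
    by measurable
  have "(\<integral>\<^sup>+x. g x \<partial>distr (lborel_fun I) (lborel_fun I) (\<lambda>x. \<lambda>i\<in>I. t i + s * x i)) =
      (\<integral>\<^sup>+x. g (\<lambda>i\<in>I. t i + s * x i) \<partial>lborel_fun I)"
    by (rule nn_integral_distr[OF m]) (simp add: g)
  then show ?thesis
    by (simp only: distr_lborel_fun_affine[OF assms(1,2)])
qed

lemma measurable_split_fst[measurable]:
  "i \<in> I \<Longrightarrow> (\<lambda>((x, z), t). (x(i := t), z)) \<in>
    (lborel_fun (I - {i}) \<Otimes>\<^sub>M lborel_fun K) \<Otimes>\<^sub>M lborel \<rightarrow>\<^sub>M lborel_fun I \<Otimes>\<^sub>M lborel_fun K"
proof -
  assume i: "i \<in> I"
  have "(\<lambda>w. (fst (fst w))(i := snd w)) \<in>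
    (lborel_fun (I - {i}) \<Otimes>\<^sub>M lborel_fun K) \<Otimes>\<^sub>M lborel \<rightarrow>\<^sub>M lborel_fun (insert i (I - {i}))"
    by (rule measurable_fun_upd[where J = "I - {i}"]) auto
  then show ?thesis using i by (simp add: case_prod_beta' insert_absorb)
qed

lemma measurable_split_snd[measurable]:
  "k \<in> K \<Longrightarrow> (\<lambda>((x, z), t). (x, z(k := t))) \<in>
    (lborel_fun I \<Otimes>\<^sub>M lborel_fun (K - {k})) \<Otimes>\<^sub>M lborel \<rightarrow>\<^sub>M lborel_fun I \<Otimes>\<^sub>M lborel_fun K"
proof -
  assume k: "k \<in> K"
  have "(\<lambda>w. (snd (fst w))(k := snd w)) \<in>
    (lborel_fun I \<Otimes>\<^sub>M lborel_fun (K - {k})) \<Otimes>\<^sub>M lborel \<rightarrow>\<^sub>M lborel_fun (insert k (K - {k}))"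
    by (rule measurable_fun_upd[where J = "K - {k}"]) auto
  then show ?thesis using k by (simp add: case_prod_beta' insert_absorb)
qed

lemma nn_integral_lborel_fun_split:
  assumes "finite I" "i \<in> I" "g \<in> borel_measurable (lborel_fun I)"
  shows "(\<integral>\<^sup>+x. g x \<partial>lborel_fun I) = (\<integral>\<^sup>+x. \<integral>\<^sup>+t. g (x(i := t)) \<partial>lborel \<partial>lborel_fun (I - {i}))"
proof -
  interpret product_sigma_finite "\<lambda>_. lborel :: real measure" ..
  show ?thesis
    using product_nn_integral_insert[of "I - {i}" i g] assms by (simp add: insert_absorb)
qed

text \<open>Tonelli is arranged so that the inserted coordinate is integrated directly inside its
  own block while the other block is fixed. Hence \<open>z\<close> is outermost here, and
  \<open>x\<close> in the companion statement for the second block.\<close>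

lemma distr_split_fst:
  assumes I: "finite I" and K: "finite K" and i: "i \<in> I"
  shows "distr ((lborel_fun (I - {i}) \<Otimes>\<^sub>M lborel_fun K) \<Otimes>\<^sub>M lborel) (lborel_fun I \<Otimes>\<^sub>M lborel_fun K)
    (\<lambda>((x, z), t). (x(i := t), z)) = lborel_fun I \<Otimes>\<^sub>M lborel_fun K" (is "distr ?N ?M ?e = _")
proof (rule measure_eqI)
  interpret P: pair_sigma_finite "lborel_fun I" "lborel_fun K"
    by (rule pair_sigma_finite_lborel_fun) fact+
  interpret P': pair_sigma_finite "lborel_fun (I - {i})" "lborel_fun K"
    by (rule pair_sigma_finite_lborel_fun) (use I K in auto)
  note measurable_split_fst[OF i, measurable]
  fix A assume "A \<in> sets (distr ?N ?M ?e)"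
  then have A[measurable]: "A \<in> sets ?M" by simp
  let ?g = "indicator A :: _ \<Rightarrow> ennreal"
  have ge: "(\<lambda>w. ?g (?e w)) \<in> borel_measurable ?N" by measurable
  have "emeasure (distr ?N ?M ?e) A = (\<integral>\<^sup>+y. ?g y \<partial>distr ?N ?M ?e)"
    by simp
  also have "\<dots> = (\<integral>\<^sup>+w. ?g (?e w) \<partial>?N)"
    by (rule nn_integral_distr) auto
  also have "\<dots> = (\<integral>\<^sup>+xz. \<integral>\<^sup>+t. ?g (?e (xz, t)) \<partial>lborel \<partial>(lborel_fun (I - {i}) \<Otimes>\<^sub>M lborel_fun K))"
    by (rule lborel.nn_integral_fst[OF ge, symmetric])
  also have "\<dots> = (\<integral>\<^sup>+z. \<integral>\<^sup>+x. \<integral>\<^sup>+t. ?g (?e ((x, z), t)) \<partial>lborel \<partial>lborel_fun (I - {i}) \<partial>lborel_fun K)"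
    by (subst P'.nn_integral_snd[symmetric]) (use ge in \<open>auto intro!: lborel.borel_measurable_nn_integral_fst\<close>)
  also have "\<dots> = (\<integral>\<^sup>+z. \<integral>\<^sup>+x. ?g (x, z) \<partial>lborel_fun I \<partial>lborel_fun K)"
    by (rule nn_integral_cong, subst nn_integral_lborel_fun_split[OF I i]) auto
  also have "\<dots> = (\<integral>\<^sup>+y. ?g y \<partial>?M)"
    by (subst P.nn_integral_snd[symmetric]) auto
  finally show "emeasure (distr ?N ?M ?e) A = emeasure ?M A" by simp
qed simp

lemma distr_split_snd:
  assumes I: "finite I" and K: "finite K" and k: "k \<in> K"
  shows "distr ((lborel_fun I \<Otimes>\<^sub>M lborel_fun (K - {k})) \<Otimes>\<^sub>M lborel) (lborel_fun I \<Otimes>\<^sub>M lborel_fun K)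
    (\<lambda>((x, z), t). (x, z(k := t))) = lborel_fun I \<Otimes>\<^sub>M lborel_fun K" (is "distr ?N ?M ?e = _")
proof (rule measure_eqI)
  interpret K: sigma_finite_measure "lborel_fun K" by (rule sigma_finite_lborel_fun[OF K])
  interpret K': sigma_finite_measure "lborel_fun (K - {k})"
    by (rule sigma_finite_lborel_fun) (use K in auto)
  note measurable_split_snd[OF k, measurable]
  fix A assume "A \<in> sets (distr ?N ?M ?e)"
  then have A[measurable]: "A \<in> sets ?M" by simp
  let ?g = "indicator A :: _ \<Rightarrow> ennreal"
  have ge: "(\<lambda>w. ?g (?e w)) \<in> borel_measurable ?N" by measurable
  have "emeasure (distr ?N ?M ?e) A = (\<integral>\<^sup>+y. ?g y \<partial>distr ?N ?M ?e)"
    by simp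
  also have "\<dots> = (\<integral>\<^sup>+w. ?g (?e w) \<partial>?N)"
    by (rule nn_integral_distr) auto
  also have "\<dots> = (\<integral>\<^sup>+xz. \<integral>\<^sup>+t. ?g (?e (xz, t)) \<partial>lborel \<partial>(lborel_fun I \<Otimes>\<^sub>M lborel_fun (K - {k})))"
    by (rule lborel.nn_integral_fst[OF ge, symmetric])
  also have "\<dots> = (\<integral>\<^sup>+x. \<integral>\<^sup>+z. \<integral>\<^sup>+t. ?g (?e ((x, z), t)) \<partial>lborel \<partial>lborel_fun (K - {k}) \<partial>lborel_fun I)"
    by (subst K'.nn_integral_fst[symmetric]) (use ge in \<open>auto intro!: lborel.borel_measurable_nn_integral_fst\<close>)
  also have "\<dots> = (\<integral>\<^sup>+x. \<integral>\<^sup>+z. ?g (x, z) \<partial>lborel_fun K \<partial>lborel_fun I)"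
    by (rule nn_integral_cong, subst nn_integral_lborel_fun_split[OF K k]) auto
  also have "\<dots> = (\<integral>\<^sup>+y. ?g y \<partial>?M)"
    by (subst K.nn_integral_fst[symmetric]) auto
  finally show "emeasure (distr ?N ?M ?e) A = emeasure ?M A" by simp
qed simp

section \<open>Minimax lower bound in a location family\<close>

abbreviation cube :: "'i set \<Rightarrow> real \<Rightarrow> ('i \<Rightarrow> real) set" where
  "cube I r \<equiv> Pi\<^sub>E I (\<lambda>_. {- r..r})"

lemma sets_cube[measurable]: "finite I \<Longrightarrow> cube I r \<in> sets (lborel_fun I)"
  by (rule sets_PiM_I_finite) auto

lemma emeasure_cube:
  assumes "finite I" "r \<ge> 0"
  shows "emeasure (lborel_fun I) (cube I r) = ennreal ((2 * r) ^ card I)"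
proof -
  interpret product_sigma_finite "\<lambda>_. lborel :: real measure" ..
  show ?thesis using assms by (subst emeasure_PiM) (auto simp: ennreal_power)
qed

text \<open>A Bayes bound for the uniform prior on a cube, left unnormalised so that only volumes
  appear. Counting just errors in the cube of radius \<open>m\<close> and observations in the cube
  of radius \<open>T - m\<close> keeps the parameter \<open>x - e\<close> inside the prior's cube,
  which removes the boundary effect. Everything is nonnegative, so infinite risks are
  covered.\<close>

lemma location_average_lower_bound:
  fixes a :: "'i \<Rightarrow> real" and g :: "('i \<Rightarrow> real) \<times> ('k \<Rightarrow> real) \<Rightarrow> ennreal"
    and \<delta> :: "('i \<Rightarrow> real) \<times> ('k \<Rightarrow> real) \<Rightarrow> 'i \<Rightarrow> real"
  assumes I: "finite I" and K: "finite K" and a0: "\<And>i. i \<in> I \<Longrightarrow> a i \<ge> 0"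
    and g[measurable]: "g \<in> borel_measurable (lborel_fun I \<Otimes>\<^sub>M lborel_fun K)"
    and sym: "\<And>e z. g (\<lambda>i\<in>I. - e i, z) = g (e, z)"
    and \<delta>: "\<And>i. i \<in> I \<Longrightarrow> (\<lambda>y. \<delta> y i) \<in> borel_measurable (lborel_fun I \<Otimes>\<^sub>M lborel_fun K)"
    and bound: "\<And>\<theta>. \<theta> \<in> I \<rightarrow>\<^sub>E UNIV \<Longrightarrow>
      (\<integral>\<^sup>+y. ennreal (\<Sum>i\<in>I. a i * (\<delta> y i - \<theta> i)\<^sup>2) * g (\<lambda>i\<in>I. fst y i - \<theta> i, snd y)
        \<partial>(lborel_fun I \<Otimes>\<^sub>M lborel_fun K)) \<le> s"
    and m0: "0 \<le> m" and T: "m \<le> T"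
  shows "ennreal ((2 * (T - m)) ^ card I) *
      (\<integral>\<^sup>+y. indicator (cube I m) (fst y) * (ennreal (\<Sum>i\<in>I. a i * (fst y i)\<^sup>2) * g y)
        \<partial>(lborel_fun I \<Otimes>\<^sub>M lborel_fun K)) \<le> s * ennreal ((2 * T) ^ card I)"
proof -
  interpret P: pair_sigma_finite "lborel_fun I" "lborel_fun K"
    by (rule pair_sigma_finite_lborel_fun) fact+
  let ?M = "lborel_fun I \<Otimes>\<^sub>M lborel_fun K"
  interpret M: sigma_finite_measure ?M by (rule sigma_finite_lborel_fun_pair) fact+
  interpret PM: pair_sigma_finite ?M "lborel_fun I" ..
  note sets_cube[OF I, measurable]
  have [measurable]: "(\<lambda>y. \<Sum>i\<in>I. a i * (\<delta> (snd y) i - fst y i)\<^sup>2) \<in> borel_measurable (lborel_fun I \<Otimes>\<^sub>M ?M)"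
  proof (intro borel_measurable_sum)
    fix i assume i: "i \<in> I"
    note \<delta>[OF i, measurable]
    show "(\<lambda>y. a i * (\<delta> (snd y) i - fst y i)\<^sup>2) \<in> borel_measurable (lborel_fun I \<Otimes>\<^sub>M ?M)"
      using i by measurable
  qed
  have [measurable]: "(\<lambda>y. \<Sum>i\<in>I. a i * (fst y i)\<^sup>2) \<in> borel_measurable ?M"
    by (intro borel_measurable_sum) measurable
  define A where "A \<theta> y = indicator (cube I T) \<theta> *
    (ennreal (\<Sum>i\<in>I. a i * (\<delta> y i - \<theta> i)\<^sup>2) * g (\<lambda>i\<in>I. fst y i - \<theta> i, snd y))" for \<theta> y
  have A[measurable]: "(\<lambda>w. A (fst w) (snd w)) \<in> borel_measurable (lborel_fun I \<Otimes>\<^sub>M ?M)"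
    unfolding A_def by measurable
  have A'[measurable]: "(\<lambda>w. A (snd w) (fst w)) \<in> borel_measurable (?M \<Otimes>\<^sub>M lborel_fun I)"
    using measurable_compose[OF measurable_pair_swap' A] by (simp add: case_prod_beta')
  define \<rho> where "\<rho> z = (\<integral>\<^sup>+e. indicator (cube I m) e * (ennreal (\<Sum>i\<in>I. a i * (e i)\<^sup>2) * g (e, z)) \<partial>lborel_fun I)" for z
  \<comment> \<open>For a fixed observation the average over \<theta> becomes an integral over the
    error \<open>e = x - \<theta>\<close>, in which the estimator enters only through its offset
    \<open>b\<close> from \<open>x\<close>.\<close>
  have inner: "indicator (cube I (T - m)) (fst y) * \<rho> (snd y) \<le> (\<integral>\<^sup>+\<theta>. A \<theta> y \<partial>lborel_fun I)"
    if y: "y \<in> space ?M" for y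
  proof (cases "fst y \<in> cube I (T - m)")
    case True
    define b where "b i = \<delta> y i - fst y i" for i
    define J where "J e = indicator (cube I m) e * (ennreal (\<Sum>i\<in>I. a i * (b i + e i)\<^sup>2) * g (e, snd y))" for e
    have gy[measurable]: "(\<lambda>e. g (e, snd y)) \<in> borel_measurable (lborel_fun I)"
      using y by (intro measurable_Pair1[OF g]) (auto simp: space_pair_measure)
    have [measurable]: "(\<lambda>e. \<Sum>i\<in>I. a i * (e i)\<^sup>2) \<in> borel_measurable (lborel_fun I)"
      "(\<lambda>e. \<Sum>i\<in>I. a i * (b i + e i)\<^sup>2) \<in> borel_measurable (lborel_fun I)"
      by (intro borel_measurable_sum; measurable)+
    have J[measurable]: "J \<in> borel_measurable (lborel_fun I)"
      unfolding J_def by measurable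
    have mneg: "(\<lambda>e. \<lambda>i\<in>I. 0 + (- 1) * e i) \<in> lborel_fun I \<rightarrow>\<^sub>M lborel_fun I"
      by measurable
    have J'[measurable]: "(\<lambda>e. J (\<lambda>i\<in>I. 0 + (- 1) * e i)) \<in> borel_measurable (lborel_fun I)"
      by (rule measurable_compose[OF mneg J])
    have "2 * \<rho> (snd y) = (\<integral>\<^sup>+e. 2 * (indicator (cube I m) e * (ennreal (\<Sum>i\<in>I. a i * (e i)\<^sup>2) * g (e, snd y))) \<partial>lborel_fun I)"
      unfolding \<rho>_def by (rule nn_integral_cmult[symmetric]) measurable
    also have "\<dots> \<le> (\<integral>\<^sup>+e. J e + J (\<lambda>i\<in>I. 0 + (- 1) * e i) \<partial>lborel_fun I)"
    proof (rule nn_integral_mono)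
      fix e assume "e \<in> space (lborel_fun I)"
      then have e: "e \<in> extensional I" by (auto simp: space_PiM PiE_iff)
      have c: "indicator (cube I m) (\<lambda>i\<in>I. - e i) = (indicator (cube I m) e :: ennreal)"
        using e by (auto simp: PiE_iff indicator_def) (metis neg_le_iff_le minus_minus)+
      \<comment> \<open>Parallelogram identity: averaging over \<open>e\<close> and
        \<open>- e\<close> cancels the cross term, and what remains of the offset \<open>b\<close>
        is a square, which can only increase the loss.\<close>
      have "2 * (\<Sum>i\<in>I. a i * (e i)\<^sup>2) \<le> (\<Sum>i\<in>I. a i * (b i + e i)\<^sup>2) + (\<Sum>i\<in>I. a i * (b i - e i)\<^sup>2)"
        unfolding sum_distrib_left sum.distrib[symmetric]
      proof (rule sum_mono)
        fix i assume "i \<in> I"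
        have "a i * (b i + e i)\<^sup>2 + a i * (b i - e i)\<^sup>2 - 2 * (a i * (e i)\<^sup>2) = 2 * (a i * (b i)\<^sup>2)"
          by (simp add: power2_eq_square algebra_simps)
        moreover have "0 \<le> 2 * (a i * (b i)\<^sup>2)" using a0[OF \<open>i \<in> I\<close>] by simp
        ultimately show "2 * (a i * (e i)\<^sup>2) \<le> a i * (b i + e i)\<^sup>2 + a i * (b i - e i)\<^sup>2" by linarith
      qed
      then have "ennreal (2 * (\<Sum>i\<in>I. a i * (e i)\<^sup>2))
          \<le> ennreal ((\<Sum>i\<in>I. a i * (b i + e i)\<^sup>2) + (\<Sum>i\<in>I. a i * (b i - e i)\<^sup>2))"
        by (rule ennreal_leI)
      also have "\<dots> = ennreal (\<Sum>i\<in>I. a i * (b i + e i)\<^sup>2) + ennreal (\<Sum>i\<in>I. a i * (b i - e i)\<^sup>2)"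
        using a0 by (intro ennreal_plus sum_nonneg) auto
      finally have le: "2 * ennreal (\<Sum>i\<in>I. a i * (e i)\<^sup>2)
          \<le> ennreal (\<Sum>i\<in>I. a i * (b i + e i)\<^sup>2) + ennreal (\<Sum>i\<in>I. a i * (b i - e i)\<^sup>2)"
        by (simp add: ennreal_mult')
      have "2 * (indicator (cube I m) e * (ennreal (\<Sum>i\<in>I. a i * (e i)\<^sup>2) * g (e, snd y))) =
          (2 * ennreal (\<Sum>i\<in>I. a i * (e i)\<^sup>2)) * (indicator (cube I m) e * g (e, snd y))"
        by (simp only: mult_ac)
      also have "\<dots> \<le> (ennreal (\<Sum>i\<in>I. a i * (b i + e i)\<^sup>2) + ennreal (\<Sum>i\<in>I. a i * (b i - e i)\<^sup>2)) *
          (indicator (cube I m) e * g (e, snd y))"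
        by (rule mult_right_mono[OF le]) simp
      also have "\<dots> = J e + J (\<lambda>i\<in>I. 0 + (- 1) * e i)"
        unfolding J_def by (simp add: c sym distrib_right distrib_left mult_ac)
      finally show "2 * (indicator (cube I m) e * (ennreal (\<Sum>i\<in>I. a i * (e i)\<^sup>2) * g (e, snd y)))
        \<le> J e + J (\<lambda>i\<in>I. 0 + (- 1) * e i)" .
    qed
    also have "\<dots> = (\<integral>\<^sup>+e. J e \<partial>lborel_fun I) + (\<integral>\<^sup>+e. J (\<lambda>i\<in>I. 0 + (- 1) * e i) \<partial>lborel_fun I)"
      by (rule nn_integral_add) measurable
    also have "(\<integral>\<^sup>+e. J (\<lambda>i\<in>I. 0 + (- 1) * e i) \<partial>lborel_fun I) = (\<integral>\<^sup>+e. J e \<partial>lborel_fun I)"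
      by (rule nn_integral_lborel_fun_affine[OF I _ J]) simp
    also have "(\<integral>\<^sup>+e. J e \<partial>lborel_fun I) + (\<integral>\<^sup>+e. J e \<partial>lborel_fun I) = 2 * (\<integral>\<^sup>+e. J e \<partial>lborel_fun I)"
      by (simp only: mult_2)
    finally have "\<rho> (snd y) \<le> (\<integral>\<^sup>+e. J e \<partial>lborel_fun I)"
      by (subst (asm) ennreal_mult_le_mult_iff) auto
    also have "\<dots> \<le> (\<integral>\<^sup>+e. A (\<lambda>i\<in>I. fst y i + (- 1) * e i) y \<partial>lborel_fun I)"
    proof (rule nn_integral_mono)
      fix e assume "e \<in> space (lborel_fun I)"
      then have e: "e \<in> extensional I" by (auto simp: space_PiM PiE_iff)
      have "(\<lambda>i\<in>I. fst y i - e i) \<in> cube I T" if "e \<in> cube I m"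
      proof (rule restrict_PiE_iff[THEN iffD2], rule ballI)
        fix i assume i: "i \<in> I"
        have "- (T - m) \<le> fst y i" "fst y i \<le> T - m" "- m \<le> e i" "e i \<le> m"
          using PiE_mem[OF True i] PiE_mem[OF that i] by auto
        then show "fst y i - e i \<in> {- T..T}" by simp
      qed
      then have "indicator (cube I m) e \<le> (indicator (cube I T) (\<lambda>i\<in>I. fst y i - e i) :: ennreal)"
        by (simp add: indicator_def)
      moreover have "(\<lambda>i\<in>I. fst y i - (\<lambda>i\<in>I. fst y i - e i) i) = e"
        using e by (auto simp: fun_eq_iff extensional_def)
      moreover have "(\<Sum>i\<in>I. a i * (\<delta> y i - (\<lambda>i\<in>I. fst y i - e i) i)\<^sup>2) = (\<Sum>i\<in>I. a i * (b i + e i)\<^sup>2)"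
        by (intro sum.cong) (auto simp: b_def algebra_simps)
      ultimately show "J e \<le> A (\<lambda>i\<in>I. fst y i + (- 1) * e i) y"
        unfolding J_def A_def by (simp add: mult_right_mono)
    qed
    also have "\<dots> = (\<integral>\<^sup>+\<theta>. A \<theta> y \<partial>lborel_fun I)"
      by (rule nn_integral_lborel_fun_affine[OF I _ measurable_Pair2[OF A' y, simplified]]) simp
    finally show ?thesis using True by simp
  qed simp
  have \<rho>[measurable]: "\<rho> \<in> borel_measurable (lborel_fun K)"
    unfolding \<rho>_def by measurable
  have "ennreal ((2 * (T - m)) ^ card I) *
      (\<integral>\<^sup>+y. indicator (cube I m) (fst y) * (ennreal (\<Sum>i\<in>I. a i * (fst y i)\<^sup>2) * g y) \<partial>?M) =
      ennreal ((2 * (T - m)) ^ card I) * (\<integral>\<^sup>+z. \<rho> z \<partial>lborel_fun K)"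
    by (subst P.nn_integral_snd[symmetric]) (auto simp: \<rho>_def[abs_def])
  also have "\<dots> = (\<integral>\<^sup>+z. \<integral>\<^sup>+x. indicator (cube I (T - m)) x * \<rho> z \<partial>lborel_fun I \<partial>lborel_fun K)"
    using T by (simp only: nn_integral_multc[OF borel_measurable_indicator[OF sets_cube[OF I]]]
      nn_integral_indicator[OF sets_cube[OF I]] emeasure_cube[OF I] diff_ge_0_iff_ge nn_integral_cmult[OF \<rho>])
  also have "\<dots> = (\<integral>\<^sup>+y. indicator (cube I (T - m)) (fst y) * \<rho> (snd y) \<partial>?M)"
  proof -
    have "(\<lambda>y. indicator (cube I (T - m)) (fst y) * \<rho> (snd y)) \<in> borel_measurable ?M"
      by measurable
    from P.nn_integral_snd[OF this] show ?thesis by (simp only: fst_conv snd_conv)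
  qed
  also have "\<dots> \<le> (\<integral>\<^sup>+y. \<integral>\<^sup>+\<theta>. A \<theta> y \<partial>lborel_fun I \<partial>?M)"
    by (rule nn_integral_mono) (rule inner)
  also have "\<dots> = (\<integral>\<^sup>+\<theta>. \<integral>\<^sup>+y. A \<theta> y \<partial>?M \<partial>lborel_fun I)"
    by (rule PM.Fubini'[symmetric]) (use A' in \<open>simp add: case_prod_beta'\<close>)
  also have "\<dots> \<le> (\<integral>\<^sup>+\<theta>. s * indicator (cube I T) \<theta> \<partial>lborel_fun I)"
  proof (rule nn_integral_mono)
    fix \<theta> assume "\<theta> \<in> space (lborel_fun I)"
    then have "\<theta> \<in> I \<rightarrow>\<^sub>E UNIV" by (simp add: space_PiM)
    from bound[OF this] show "(\<integral>\<^sup>+y. A \<theta> y \<partial>?M) \<le> s * indicator (cube I T) \<theta>"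
      by (auto simp: A_def indicator_def)
  qed
  also have "\<dots> = s * ennreal ((2 * T) ^ card I)"
    using T m0 by (simp add: nn_integral_cmult_indicator I emeasure_cube)
  finally show ?thesis .
qed

text \<open>Two limits in this order: for fixed \<open>m\<close> the volume ratio
  \<open>((T - m) / T) ^ card I\<close> tends to 1 as the prior spreads out; then monotone
  convergence in \<open>m\<close> removes the truncation of the error.\<close>

lemma location_minimax_lower_bound:
  fixes a :: "'i \<Rightarrow> real" and g :: "('i \<Rightarrow> real) \<times> ('k \<Rightarrow> real) \<Rightarrow> ennreal"
    and \<delta> :: "('i \<Rightarrow> real) \<times> ('k \<Rightarrow> real) \<Rightarrow> 'i \<Rightarrow> real"
  assumes I: "finite I" and K: "finite K" and a0: "\<And>i. i \<in> I \<Longrightarrow> a i \<ge> 0"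
    and g[measurable]: "g \<in> borel_measurable (lborel_fun I \<Otimes>\<^sub>M lborel_fun K)"
    and sym: "\<And>e z. g (\<lambda>i\<in>I. - e i, z) = g (e, z)"
    and \<delta>: "\<And>i. i \<in> I \<Longrightarrow> (\<lambda>y. \<delta> y i) \<in> borel_measurable (lborel_fun I \<Otimes>\<^sub>M lborel_fun K)"
    and bound: "\<And>\<theta>. \<theta> \<in> I \<rightarrow>\<^sub>E UNIV \<Longrightarrow>
      (\<integral>\<^sup>+y. ennreal (\<Sum>i\<in>I. a i * (\<delta> y i - \<theta> i)\<^sup>2) * g (\<lambda>i\<in>I. fst y i - \<theta> i, snd y)
        \<partial>(lborel_fun I \<Otimes>\<^sub>M lborel_fun K)) \<le> s"
  shows "(\<integral>\<^sup>+y. ennreal (\<Sum>i\<in>I. a i * (fst y i)\<^sup>2) * g y \<partial>(lborel_fun I \<Otimes>\<^sub>M lborel_fun K)) \<le> s"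
proof -
  let ?M = "lborel_fun I \<Otimes>\<^sub>M lborel_fun K"
  let ?L = "\<lambda>y. ennreal (\<Sum>i\<in>I. a i * (fst y i)\<^sup>2) * g y"
  note sets_cube[OF I, measurable]
  have [measurable]: "(\<lambda>y. \<Sum>i\<in>I. a i * (fst y i)\<^sup>2) \<in> borel_measurable ?M"
    by (intro borel_measurable_sum) measurable
  define R where "R m = (\<integral>\<^sup>+y. indicator (cube I (real m)) (fst y) * ?L y \<partial>?M)" for m :: nat
  have R: "R m \<le> s" for m
  proof (rule LIMSEQ_le_const2)
    \<comment> \<open>The prior's cube has radius \<open>real (T + m) + 1\<close>, which is positive
      and at least \<open>m\<close> for every index.\<close>
    have "(\<lambda>T. ((real (T + m) + 1 - real m) / (real (T + m) + 1)) ^ card I) \<longlonglongrightarrow> 1 ^ card I"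
      by (intro tendsto_power) real_asymp
    then have "(\<lambda>T. ennreal (((real (T + m) + 1 - real m) / (real (T + m) + 1)) ^ card I)) \<longlonglongrightarrow> ennreal 1"
      by (intro tendsto_ennrealI) simp
    then show "(\<lambda>T. ennreal (((real (T + m) + 1 - real m) / (real (T + m) + 1)) ^ card I) * R m) \<longlonglongrightarrow> R m"
      using tendsto_mult_ennreal[OF _ tendsto_const, of _ 1 sequentially "R m"] by simp
    show "\<exists>N. \<forall>n\<ge>N. ennreal (((real (n + m) + 1 - real m) / (real (n + m) + 1)) ^ card I) * R m \<le> s"
    proof (intro exI allI impI)
      fix n :: nat
      define T where "T = real (n + m) + 1"
      have T: "T > 0" "real m \<le> T" by (auto simp: T_def)
      have inv: "ennreal (inverse x) * ennreal x = 1" if "x > 0" for x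
        using that by (simp flip: ennreal_mult)
      have "ennreal ((2 * (T - real m)) ^ card I) * R m \<le> s * ennreal ((2 * T) ^ card I)"
        unfolding R_def by (rule location_average_lower_bound[OF I K a0 g sym \<delta> bound _ T(2)]) auto
      then have "ennreal (inverse ((2 * T) ^ card I)) * (ennreal ((2 * (T - real m)) ^ card I) * R m)
          \<le> ennreal (inverse ((2 * T) ^ card I)) * (s * ennreal ((2 * T) ^ card I))"
        by (rule mult_left_mono) simp
      also have "\<dots> = s * (ennreal (inverse ((2 * T) ^ card I)) * ennreal ((2 * T) ^ card I))"
        by (simp only: mult_ac)
      also have "ennreal (inverse ((2 * T) ^ card I)) * ennreal ((2 * T) ^ card I) = 1"
        by (rule inv) (use T in simp)
      also have "ennreal (inverse ((2 * T) ^ card I)) * (ennreal ((2 * (T - real m)) ^ card I) * R m) =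
          ennreal (inverse ((2 * T) ^ card I) * (2 * (T - real m)) ^ card I) * R m"
        using T by (simp add: ennreal_mult mult.assoc)
      also have "inverse ((2 * T) ^ card I) * (2 * (T - real m)) ^ card I = ((T - real m) / T) ^ card I"
        using T unfolding power_mult_distrib power_divide by (simp add: field_simps)
      finally show "ennreal (((real (n + m) + 1 - real m) / (real (n + m) + 1)) ^ card I) * R m \<le> s"
        by (simp add: T_def)
    qed
  qed
  have "(\<integral>\<^sup>+y. ?L y \<partial>?M) \<le> (\<integral>\<^sup>+y. (SUP m. indicator (cube I (real m)) (fst y) * ?L y) \<partial>?M)"
  proof (rule nn_integral_mono)
    fix y assume "y \<in> space ?M"
    then have e: "fst y \<in> extensional I" by (auto simp: space_pair_measure space_PiM PiE_iff)
    obtain m where m: "(\<Sum>i\<in>I. \<bar>fst y i\<bar>) \<le> real m" using real_arch_simple by blast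
    have "\<bar>fst y i\<bar> \<le> real m" if "i \<in> I" for i
      using member_le_sum[of i I "\<lambda>i. \<bar>fst y i\<bar>"] that I m by auto
    then have "fst y \<in> cube I (real m)" using e by (auto simp: PiE_iff abs_le_iff minus_le_iff)
    then have "?L y = indicator (cube I (real m)) (fst y) * ?L y" by simp
    also have "\<dots> \<le> (SUP m. indicator (cube I (real m)) (fst y) * ?L y)" by (rule SUP_upper) simp
    finally show "?L y \<le> (SUP m. indicator (cube I (real m)) (fst y) * ?L y)" .
  qed
  also have "\<dots> = (SUP m. R m)"
    unfolding R_def
  proof (rule nn_integral_monotone_convergence_SUP)
    show "incseq (\<lambda>m y. indicator (cube I (real m)) (fst y) * ?L y)"
    proof (intro incseq_SucI le_funI mult_right_mono)
      fix m and y :: "('i \<Rightarrow> real) \<times> ('k \<Rightarrow> real)"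
      have "cube I (real m) \<subseteq> cube I (real (Suc m))" by (rule PiE_mono) auto
      then show "indicator (cube I (real m)) (fst y) \<le> (indicator (cube I (real (Suc m))) (fst y) :: ennreal)"
        by (auto simp: indicator_def)
    qed simp
  qed measurable
  also have "\<dots> \<le> s" by (rule SUP_least) (rule R)
  finally show ?thesis .
qed

section \<open>Risk of shrinkage estimators\<close>

text \<open>Includes \<open>q = 0\<close>, where total division gives 0; the shares of single
  coordinates in a quadratic form are thus bounded on null sets as well.\<close>

lemma frac_unit:
  fixes n q :: real
  assumes "0 \<le> n" "n \<le> q"
  shows "0 \<le> n / q" "n / q \<le> 1"
  using assms by (auto simp: divide_le_eq_1)

text \<open>The setting for one fixed \<sigma>, whose square is absorbed in the loss weights
  \<open>a\<close> and in \<open>M\<close>. The assumption \<open>lM\<close> is the sign condition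
  on the divergence. A second index in \<open>I\<close> provides a coordinate that is almost surely
  nonzero, which keeps \<open>q\<close> positive along coordinate lines.\<close>

locale shrinkage =
  fixes I :: "'i set" and K :: "'k set" and a c d :: "'i \<Rightarrow> real"
    and \<phi> \<phi>' :: "real \<Rightarrow> real" and v l M :: real
  assumes I: "finite I" and K: "finite K" and I2: "2 \<le> card I"
    and a: "\<And>i. i \<in> I \<Longrightarrow> 0 \<le> a i" and c: "\<And>i. i \<in> I \<Longrightarrow> 0 < c i" and d: "\<And>i. i \<in> I \<Longrightarrow> 0 < d i"
    and der: "\<And>w. 0 < w \<Longrightarrow> (\<phi> has_real_derivative \<phi>' w) (at w)"
    and \<phi>'0: "\<And>w. 0 < w \<Longrightarrow> 0 \<le> \<phi>' w" and \<phi>0: "\<And>w. 0 < w \<Longrightarrow> 0 \<le> \<phi> w"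
    and \<phi>v: "\<And>w. 0 < w \<Longrightarrow> \<phi> w / w \<le> v" and \<phi>l: "\<And>w. 0 < w \<Longrightarrow> \<phi> w \<le> l"
    and M: "\<And>i. i \<in> I \<Longrightarrow> a i * d i / c i \<le> M"
    and lM: "(real (card K) + 2) * l * M \<le> 2 * (\<Sum>i\<in>I. a i * d i / c i) - 4 * M"
begin

text \<open>Cutting off at 0 gives functions that are Borel measurable on the whole line and lets
  the fields vanish wherever total division yields \<open>W y = 0\<close>.\<close>

definition "\<Phi> w = (if 0 < w then \<phi> w else 0)"
definition "\<Phi>' w = (if 0 < w then \<phi>' w else 0)"
definition "\<rho> w = \<Phi> w / w"
definition "q x = (\<Sum>i\<in>I. (x i)\<^sup>2 / (c i * d i))"
definition "S z = (\<Sum>k\<in>K. (z k :: real)\<^sup>2)"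
definition "W y = q (fst y) / S (snd y)"
definition "N x = (\<Sum>i\<in>I. a i * (x i)\<^sup>2 / (c i)\<^sup>2)"
definition "est y i = (1 - \<rho> (W y) / c i) * fst y i"

text \<open>Up to scaling, \<open>(X1, X2)\<close> is the vector field whose divergence is an unbiased estimator of
  the difference in risk; \<open>X2\<close> is tailored to \<open>\<Sum>k. z k * X2 k = \<rho>\<^sup>2 * N\<close>.\<close>

definition "X1 i y = - 2 * (a i / c i) * (\<rho> (W y) * fst y i)"
definition "X2 k y = snd y k * (\<rho> (W y) * \<Phi> (W y)) * (N (fst y) / q (fst y))"
text \<open>The partial derivatives are written through the shares of one coordinate in
  \<open>q\<close> and in \<open>S\<close>. Shares lie in [0, 1], which gives bounds for single
  coordinates, and sum to 1 where the form is positive, which gives the divergence.\<close>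

definition "dX1 i y = - 2 * (a i / c i) *
  (\<rho> (W y) + (\<Phi>' (W y) - \<rho> (W y)) * (2 * ((fst y i)\<^sup>2 / (c i * d i) / q (fst y))))"
definition "dX2 k y = (\<rho> (W y) * \<Phi> (W y) - 4 * \<Phi> (W y) * \<Phi>' (W y) * ((snd y k)\<^sup>2 / S (snd y))
    + 2 * \<rho> (W y) * \<Phi> (W y) * ((snd y k)\<^sup>2 / S (snd y))) * (N (fst y) / q (fst y))"

section \<open>Bounds and measurability of the ingredients\<close>

lemma v0: "0 \<le> v" using \<phi>v[of 1] \<phi>0[of 1] by simp
lemma l0: "0 \<le> l" using \<phi>l[of 1] \<phi>0[of 1] by simp
lemma M0: "0 \<le> M"
proof -
  obtain i where "i \<in> I" using I2 by fastforce
  then show ?thesis using M[of i] a[of i] c[of i] d[of i]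
    by (meson divide_nonneg_pos less_imp_le mult_nonneg_nonneg order_trans)
qed

lemma \<Phi>0: "0 \<le> \<Phi> w" and \<Phi>l: "\<Phi> w \<le> l" and \<Phi>'0: "0 \<le> \<Phi>' w"
  using \<phi>0 \<phi>l \<phi>'0 l0 by (auto simp: \<Phi>_def \<Phi>'_def)
lemma \<rho>0: "0 \<le> \<rho> w" and \<rho>v: "\<rho> w \<le> v"
  using \<phi>0 \<phi>v v0 by (auto simp: \<rho>_def \<Phi>_def)
lemma q0: "0 \<le> q x" unfolding q_def using c d by (intro sum_nonneg) (simp add: less_imp_le)
lemma S0: "0 \<le> S z" unfolding S_def by (intro sum_nonneg) simp
lemma N0: "0 \<le> N x" unfolding N_def using a by (intro sum_nonneg) simp

text \<open>\<open>N x / q x\<close> is a weighted mean of the numbers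
  \<open>a i * d i / c i\<close>, with weights \<open>(x i)^2 / (c i * d i)\<close>.\<close>

lemma N_le: "N x \<le> M * q x"
  unfolding N_def q_def sum_distrib_left
proof (rule sum_mono)
  fix i assume i: "i \<in> I"
  have "a i * (x i)\<^sup>2 / (c i)\<^sup>2 = a i * d i / c i * ((x i)\<^sup>2 / (c i * d i))"
    using c[OF i] d[OF i] by (simp add: field_simps power2_eq_square)
  also have "\<dots> \<le> M * ((x i)\<^sup>2 / (c i * d i))"
    using M[OF i] c[OF i] d[OF i] by (intro mult_right_mono) auto
  finally show "a i * (x i)\<^sup>2 / (c i)\<^sup>2 \<le> M * ((x i)\<^sup>2 / (c i * d i))" .
qed

lemma Nq0: "0 \<le> N x / q x" and Nq_le: "N x / q x \<le> M"
  using N0[of x] q0[of x] N_le[of x] M0 by (auto simp: divide_le_eq)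

lemma measurable_\<Phi>[measurable]: "\<Phi> \<in> borel_measurable borel"
proof -
  have "continuous_on {0<..} \<phi>"
    using der by (meson DERIV_isCont continuous_at_imp_continuous_on greaterThan_iff)
  then have "(\<lambda>x. indicator {0<..} x *\<^sub>R \<phi> x) \<in> borel_measurable borel"
    by (intro borel_measurable_continuous_on_indicator) auto
  also have "(\<lambda>x. indicator {0<..} x *\<^sub>R \<phi> x) = \<Phi>"
    by (auto simp: \<Phi>_def fun_eq_iff)
  finally show ?thesis .
qed

text \<open>A derivative is a pointwise limit of difference quotients, whatever its regularity.
  Increments to the right stay in the positive half-line, where \<Phi> agrees with \<phi>.\<close>

lemma measurable_\<Phi>'[measurable]: "\<Phi>' \<in> borel_measurable borel"
proof (rule borel_measurable_LIMSEQ_real)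
  fix w :: real
  show "(\<lambda>m. if 0 < w then (\<Phi> (w + inverse (real (Suc m))) - \<Phi> w) / inverse (real (Suc m)) else 0)
      \<longlonglongrightarrow> \<Phi>' w"
  proof (cases "0 < w")
    case True
    have "((\<lambda>h. (\<phi> (w + h) - \<phi> w) / h) \<longlongrightarrow> \<phi>' w) (at 0)"
      using der[OF True] by (simp add: DERIV_def)
    moreover have "filterlim (\<lambda>m. inverse (real (Suc m))) (at 0) sequentially"
      using LIMSEQ_inverse_real_of_nat by (auto simp: filterlim_at)
    ultimately have "(\<lambda>m. (\<phi> (w + inverse (real (Suc m))) - \<phi> w) / inverse (real (Suc m))) \<longlonglongrightarrow> \<phi>' w"
      by (rule filterlim_compose)
    moreover have "0 < w + inverse (real (Suc m))" for m using True by (simp add: add_pos_pos)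
    ultimately show ?thesis using True by (simp add: \<Phi>_def \<Phi>'_def)
  qed (simp add: \<Phi>'_def)
qed measurable

lemma measurable_\<rho>[measurable]: "\<rho> \<in> borel_measurable borel"
  unfolding \<rho>_def[abs_def] by measurable

lemma measurable_q[measurable]: "q \<in> borel_measurable (lborel_fun I)"
  unfolding q_def[abs_def] by measurable
lemma measurable_N[measurable]: "N \<in> borel_measurable (lborel_fun I)"
  unfolding N_def[abs_def] by measurable
lemma measurable_S[measurable]: "S \<in> borel_measurable (lborel_fun K)"
  unfolding S_def[abs_def] by measurable

abbreviation "\<MM> \<equiv> lborel_fun I \<Otimes>\<^sub>M lborel_fun K"

lemma measurable_W[measurable]: "W \<in> borel_measurable \<MM>"
  unfolding W_def[abs_def] by measurable

lemma measurable_est: "i \<in> I \<Longrightarrow> (\<lambda>y. est y i) \<in> borel_measurable \<MM>"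
  unfolding est_def by measurable

lemma measurable_X[measurable]:
  "i \<in> I \<Longrightarrow> X1 i \<in> borel_measurable \<MM>" "i \<in> I \<Longrightarrow> dX1 i \<in> borel_measurable \<MM>"
  "k \<in> K \<Longrightarrow> X2 k \<in> borel_measurable \<MM>" "k \<in> K \<Longrightarrow> dX2 k \<in> borel_measurable \<MM>"
  unfolding X1_def[abs_def] dX1_def[abs_def] X2_def[abs_def] dX2_def[abs_def] by measurable

section \<open>Derivatives of the field along coordinate lines\<close>

lemma has_derivative_first_block:
  assumes b: "b > 0" and m: "m > 0" and s: "s > 0"
  shows "((\<lambda>t. \<rho> ((b + t\<^sup>2 / m) / s) * t) has_real_derivative
    \<rho> ((b + t\<^sup>2 / m) / s) + (\<Phi>' ((b + t\<^sup>2 / m) / s) - \<rho> ((b + t\<^sup>2 / m) / s)) * (2 * (t\<^sup>2 / m / (b + t\<^sup>2 / m))))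
    (at t)"
proof -
  define w where "w t = (b + t\<^sup>2 / m) / s" for t
  \<comment> \<open>The contribution \<open>b\<close> of the other coordinates keeps the argument of
    \<phi> positive even at \<open>t = 0\<close>.\<close>
  have w: "w t > 0" for t using b m s by (auto simp: w_def intro!: divide_pos_pos add_pos_nonneg)
  have "(w has_real_derivative 2 * t / m / s) (at t)"
    unfolding w_def[abs_def] using m s by (auto intro!: derivative_eq_intros)
  from DERIV_chain2[OF der[OF w] this]
  have "((\<lambda>t. \<phi> (w t)) has_real_derivative \<phi>' (w t) * (2 * t / m / s)) (at t)" .
  then have "((\<lambda>t. \<phi> (w t) / w t * t) has_real_derivative
      (\<phi>' (w t) * (2 * t / m / s) * w t - \<phi> (w t) * (2 * t / m / s)) / (w t * w t) * t + \<phi> (w t) / w t) (at t)"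
    using w[of t] \<open>(w has_real_derivative 2 * t / m / s) (at t)\<close>
    by (auto intro!: derivative_eq_intros simp: field_simps)
  also have "(\<phi>' (w t) * (2 * t / m / s) * w t - \<phi> (w t) * (2 * t / m / s)) / (w t * w t) * t + \<phi> (w t) / w t =
      \<phi> (w t) / w t + (\<phi>' (w t) - \<phi> (w t) / w t) * (2 * (t\<^sup>2 / m / (s * w t)))"
    using w[of t] m s by (simp add: field_simps power2_eq_square)
  also have "s * w t = b + t\<^sup>2 / m" using s by (simp add: w_def)
  finally have *: "((\<lambda>t. \<phi> (w t) / w t * t) has_real_derivative
    \<phi> (w t) / w t + (\<phi>' (w t) - \<phi> (w t) / w t) * (2 * (t\<^sup>2 / m / (b + t\<^sup>2 / m)))) (at t)" .
  have "\<rho> (w t) = \<phi> (w t) / w t" "\<Phi>' (w t) = \<phi>' (w t)" for t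
    using w[of t] by (auto simp: \<rho>_def \<Phi>_def \<Phi>'_def)
  with * show ?thesis unfolding w_def by simp
qed

text \<open>Here \<open>s = 0\<close> cannot be excluded: with a single coordinate in
  \<open>z\<close> every line passes through \<open>z = 0\<close>, where \<open>W\<close> blows up
  and total division replaces its value by 0. Boundedness of \<phi> makes this singularity
  removable.\<close>

lemma has_derivative_second_block:
  assumes b: "b > 0" and s: "s \<ge> 0"
  shows "((\<lambda>t. t * (\<rho> (b / (s + t\<^sup>2)) * \<Phi> (b / (s + t\<^sup>2)))) has_real_derivative
    \<rho> (b / (s + t\<^sup>2)) * \<Phi> (b / (s + t\<^sup>2))
    - 4 * \<Phi> (b / (s + t\<^sup>2)) * \<Phi>' (b / (s + t\<^sup>2)) * (t\<^sup>2 / (s + t\<^sup>2))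
    + 2 * \<rho> (b / (s + t\<^sup>2)) * \<Phi> (b / (s + t\<^sup>2)) * (t\<^sup>2 / (s + t\<^sup>2))) (at t)" (is "(?f has_real_derivative ?D) _")
proof (cases "s + t\<^sup>2 > 0")
  case True
  define r where "r t = s + t\<^sup>2" for t
  define w where "w t = b / r t" for t
  have r: "r t > 0" using True by (simp add: r_def)
  have w: "w t > 0" if "r t > 0" for t using b that by (simp add: w_def)
  have dr: "(r has_real_derivative 2 * t) (at t)"
    unfolding r_def[abs_def] by (auto intro!: derivative_eq_intros)
  then have dw: "(w has_real_derivative - (b * (2 * t)) / (r t * r t)) (at t)"
    unfolding w_def[abs_def] using r by (auto intro!: derivative_eq_intros)
  from DERIV_chain2[OF der[OF w[OF r]] this]
  have d\<phi>: "((\<lambda>t. \<phi> (w t)) has_real_derivative \<phi>' (w t) * (- (b * (2 * t)) / (r t * r t))) (at t)" .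
  \<comment> \<open>As \<open>w = b / r\<close>, the product of \<rho> and \<Phi> equals
    \<open>\<phi> (w t)^2 * r t / b\<close>, whose only denominator is constant.\<close>
  have "((\<lambda>t. t * (\<phi> (w t) * \<phi> (w t) * (r t / b))) has_real_derivative
      \<phi> (w t) * \<phi> (w t) * (r t / b) + t * (2 * \<phi> (w t) * (\<phi>' (w t) * (- (b * (2 * t)) / (r t * r t))) * (r t / b)
        + \<phi> (w t) * \<phi> (w t) * (2 * t / b))) (at t)"
    using b by (auto intro!: derivative_eq_intros d\<phi> dr simp: field_simps)
  also have "\<phi> (w t) * \<phi> (w t) * (r t / b) + t * (2 * \<phi> (w t) * (\<phi>' (w t) * (- (b * (2 * t)) / (r t * r t))) * (r t / b)
        + \<phi> (w t) * \<phi> (w t) * (2 * t / b)) =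
      \<phi> (w t) / w t * \<phi> (w t) - 4 * \<phi> (w t) * \<phi>' (w t) * (t\<^sup>2 / r t) + 2 * (\<phi> (w t) / w t) * \<phi> (w t) * (t\<^sup>2 / r t)"
    using b r by (simp add: w_def field_simps power2_eq_square)
  also have "\<dots> = ?D"
    using w[OF r] unfolding \<rho>_def \<Phi>_def \<Phi>'_def w_def r_def by simp
  finally show ?thesis
  proof (rule has_field_derivative_transform_within_open)
    show "open {t. r t > 0}" unfolding r_def by (intro open_Collect_less continuous_intros)
    show "t \<in> {t. r t > 0}" using r by simp
    fix t assume "t \<in> {t. r t > 0}"
    then show "t * (\<phi> (w t) * \<phi> (w t) * (r t / b)) = ?f t"
      using w[of t] by (simp add: \<rho>_def \<Phi>_def w_def r_def)
  qed
next
  case False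
  moreover have "0 \<le> t\<^sup>2" by simp
  ultimately have "s = 0" "t\<^sup>2 = 0" using s by linarith+
  then have st: "s = 0" "t = 0" by auto
  \<comment> \<open>The difference quotient at the origin is at most \<open>l * l * h^2 / b\<close>.
    The resulting derivative 0 agrees with the value that total division assigns to
    \<open>?D\<close>.\<close>
  have "((\<lambda>h. ?f h / h) \<longlongrightarrow> 0) (at 0)"
  proof (rule Lim_null_comparison)
    show "((\<lambda>h. l * l * h\<^sup>2 / b) \<longlongrightarrow> 0) (at 0)"
      using b by (auto intro!: tendsto_eq_intros)
    show "\<forall>\<^sub>F h in at 0. norm (?f h / h) \<le> l * l * h\<^sup>2 / b"
    proof (intro eventually_at_topological[THEN iffD2] exI[of _ UNIV] conjI ballI impI)
      fix h :: real assume h: "h \<noteq> 0"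
      then have w: "0 < b / h\<^sup>2" using b by simp
      have "norm (?f h / h) = \<Phi> (b / h\<^sup>2) * \<Phi> (b / h\<^sup>2) * h\<^sup>2 / b"
        using h b \<Phi>0[of "b / h\<^sup>2"] by (simp add: st \<rho>_def abs_mult)
      also have "\<dots> \<le> l * l * h\<^sup>2 / b"
        using b \<Phi>0 \<Phi>l l0 by (intro divide_right_mono mult_right_mono mult_mono) auto
      finally show "norm (?f h / h) \<le> l * l * h\<^sup>2 / b" .
    qed auto
  qed
  then have "(?f has_real_derivative 0) (at 0)" by (simp add: DERIV_def st)
  then show ?thesis by (simp add: st \<rho>_def)
qed

lemma q_upd: "i \<in> I \<Longrightarrow> q (x(i := t)) = (\<Sum>i'\<in>I - {i}. (x i')\<^sup>2 / (c i' * d i')) + t\<^sup>2 / (c i * d i)"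
  unfolding q_def using I by (subst sum.remove[of _ i]) (auto intro!: sum.cong)

lemma S_upd: "k \<in> K \<Longrightarrow> S (z(k := t)) = (\<Sum>k'\<in>K - {k}. (z k')\<^sup>2) + t\<^sup>2"
  unfolding S_def using K by (subst sum.remove[of _ k]) (auto intro!: sum.cong)

text \<open>The nonzero coordinate \<open>i0\<close> keeps the line away from \<open>q = 0\<close>.
  If \<open>S z = 0\<close>, then \<open>W\<close> is 0 all along the line and the field vanishes
  there.\<close>

lemma has_derivative_X1:
  assumes i: "i \<in> I" and i0: "i0 \<in> I - {i}" "x i0 \<noteq> 0"
  shows "((\<lambda>t. X1 i (x(i := t), z)) has_real_derivative dX1 i (x(i := t), z)) (at t)"
proof (cases "S z > 0")
  case True
  define b where "b = (\<Sum>i'\<in>I - {i}. (x i')\<^sup>2 / (c i' * d i'))"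
  have b: "b > 0"
    unfolding b_def using i0 I c d by (intro sum_pos2[of _ i0]) (auto simp: less_imp_le)
  have m: "c i * d i > 0" using c d i by simp
  have qt: "q (x(i := t)) = b + t\<^sup>2 / (c i * d i)" for t
    unfolding b_def by (rule q_upd[OF i])
  show ?thesis
    unfolding X1_def dX1_def W_def fst_conv snd_conv qt fun_upd_same
    by (intro DERIV_cmult has_derivative_first_block b m True)
next
  case False
  then have "S z = 0" using S0[of z] by simp
  then show ?thesis by (simp add: X1_def dX1_def W_def \<rho>_def \<Phi>_def \<Phi>'_def)
qed

lemma has_derivative_X2:
  assumes k: "k \<in> K"
  shows "((\<lambda>t. X2 k (x, z(k := t))) has_real_derivative dX2 k (x, z(k := t))) (at t)"
proof (cases "q x > 0")
  case True
  have "0 \<le> (\<Sum>k'\<in>K - {k}. (z k')\<^sup>2)" by (intro sum_nonneg) simp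
  with True show ?thesis
    unfolding X2_def dX2_def W_def fst_conv snd_conv S_upd[OF k] fun_upd_same
    by (intro DERIV_cmult_right has_derivative_second_block)
next
  case False
  then have "q x = 0" using q0[of x] by simp
  then show ?thesis by (simp add: X2_def dX2_def)
qed

section \<open>One-sided derivative bounds and the sign of the divergence\<close>

lemma q_coord_le: "i \<in> I \<Longrightarrow> (x i)\<^sup>2 / (c i * d i) \<le> q x"
  unfolding q_def using I c d by (intro member_le_sum) (auto simp: less_imp_le)

lemma dX1_le: "i \<in> I \<Longrightarrow> dX1 i y \<le> 4 * (a i / c i) * v"
proof -
  assume i: "i \<in> I"
  define t where "t = (fst y i)\<^sup>2 / (c i * d i) / q (fst y)"
  have t: "0 \<le> t" "t \<le> 1"
    using frac_unit[OF _ q_coord_le[OF i, of "fst y"]] c[OF i] d[OF i] by (auto simp: t_def)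
  have "- (\<rho> (W y) + (\<Phi>' (W y) - \<rho> (W y)) * (2 * t)) \<le> 2 * v"
  proof -
    have "0 \<le> \<Phi>' (W y) * t" using \<Phi>'0 t by simp
    moreover have "\<rho> (W y) * t \<le> v * 1" using \<rho>0 \<rho>v v0 t by (intro mult_mono) auto
    ultimately show ?thesis using \<rho>0[of "W y"] by (simp add: algebra_simps)
  qed
  define \<alpha> where "\<alpha> = a i / c i"
  have "\<alpha> \<ge> 0" using a[OF i] c[OF i] by (simp add: \<alpha>_def)
  from mult_left_mono[OF \<open>- _ \<le> _\<close> this] show ?thesis
    unfolding dX1_def t_def[symmetric] \<alpha>_def[symmetric] by (simp add: algebra_simps)
qed

text \<open>The 3 is 1 from differentiating the factor \<open>z k\<close> and 2 from differentiating
  \<open>1 / W\<close> in \<open>\<Phi>^2 / W\<close>, where the share of \<open>z k\<close> in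
  \<open>S\<close> is at most 1.\<close>

lemma dX2_le: "k \<in> K \<Longrightarrow> dX2 k y \<le> 3 * v * l * M"
proof -
  assume k: "k \<in> K"
  define t where "t = (snd y k)\<^sup>2 / S (snd y)"
  have "(snd y k)\<^sup>2 \<le> S (snd y)"
    unfolding S_def using K k by (intro member_le_sum) auto
  then have t: "0 \<le> t" "t \<le> 1"
    using frac_unit[of "(snd y k)\<^sup>2" "S (snd y)"] by (auto simp: t_def)
  have r: "\<rho> (W y) * \<Phi> (W y) \<le> v * l" "0 \<le> \<rho> (W y) * \<Phi> (W y)"
    by (intro mult_mono mult_nonneg_nonneg \<rho>v \<Phi>l v0 \<Phi>0 \<rho>0)+
  have "\<rho> (W y) * \<Phi> (W y) * t \<le> v * l * 1"
    using r t v0 l0 by (intro mult_mono[OF r(1)]) auto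
  moreover have "0 \<le> \<Phi> (W y) * \<Phi>' (W y) * t" using \<Phi>'0 \<Phi>0 t by simp
  ultimately have "\<rho> (W y) * \<Phi> (W y) - 4 * \<Phi> (W y) * \<Phi>' (W y) * t + 2 * \<rho> (W y) * \<Phi> (W y) * t \<le> 3 * v * l"
    using r(1) by linarith
  then have "(\<rho> (W y) * \<Phi> (W y) - 4 * \<Phi> (W y) * \<Phi>' (W y) * t + 2 * \<rho> (W y) * \<Phi> (W y) * t) *
      (N (fst y) / q (fst y)) \<le> 3 * v * l * (N (fst y) / q (fst y))"
    using Nq0 by (rule mult_right_mono)
  also have "\<dots> \<le> 3 * v * l * M"
    using Nq_le v0 l0 by (intro mult_left_mono) auto
  finally show ?thesis by (simp add: dX2_def t_def)
qed

text \<open>The weights \<open>d i\<close> are the relative variances with which the coordinates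
  enter integration by parts. Once shares are summed, only the trace \<open>A\<close> and the mean
  \<open>\<mu> = N x / q x\<close> survive, and \<open>\<mu> \<le> M\<close> turns the sign into a
  condition on the bound \<open>l\<close>.\<close>

lemma divergence_le_0: "(\<Sum>i\<in>I. d i * dX1 i y) + (\<Sum>k\<in>K. dX2 k y) \<le> 0"
proof (cases "0 < W y")
  case True
  define x z where "x = fst y" and "z = snd y"
  have qS: "q x > 0" "S z > 0"
    using True q0[of x] S0[of z] by (auto simp: W_def x_def z_def zero_less_divide_iff)
  define w where "w = W y"
  define A where "A = (\<Sum>i\<in>I. a i * d i / c i)"
  define n where "n = real (card K)"
  define \<mu> where "\<mu> = N x / q x"
  have \<mu>: "0 \<le> \<mu>" "\<mu> \<le> M" using Nq0 Nq_le by (auto simp: \<mu>_def)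
  have "(\<Sum>i\<in>I. d i * dX1 i y) = (\<Sum>i\<in>I. - 2 * \<rho> w * (a i * d i / c i) +
      - 4 * (\<Phi>' w - \<rho> w) / q x * (a i * (x i)\<^sup>2 / (c i)\<^sup>2))"
  proof (rule sum.cong)
    fix i assume "i \<in> I"
    then have "c i > 0" "d i > 0" using c d by auto
    then show "d i * dX1 i y = - 2 * \<rho> w * (a i * d i / c i) +
      - 4 * (\<Phi>' w - \<rho> w) / q x * (a i * (x i)\<^sup>2 / (c i)\<^sup>2)"
      using qS by (simp add: dX1_def flip: w_def x_def) (simp add: field_simps power2_eq_square)
  qed simp
  also have "\<dots> = - 2 * \<rho> w * A - 4 * (\<Phi>' w - \<rho> w) * \<mu>"
    by (simp only: sum.distrib sum_distrib_left[symmetric] A_def \<mu>_def N_def)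
      (simp add: algebra_simps diff_divide_distrib)
  finally have s1: "(\<Sum>i\<in>I. d i * dX1 i y) = - 2 * \<rho> w * A - 4 * (\<Phi>' w - \<rho> w) * \<mu>" .
  have "(\<Sum>k\<in>K. (z k)\<^sup>2 / S z) = 1"
    using qS by (simp add: sum_divide_distrib[symmetric] S_def)
  \<comment> \<open>The \<open>n\<close> comes from differentiating each factor \<open>z k\<close>,
    the additional 2 from \<open>1 / W\<close> after summing the shares.\<close>
  then have s2: "(\<Sum>k\<in>K. dX2 k y) = (n * (\<rho> w * \<Phi> w) - 4 * \<Phi> w * \<Phi>' w + 2 * \<rho> w * \<Phi> w) * \<mu>"
  proof -
    have "(\<Sum>k\<in>K. dX2 k y) = (\<Sum>k\<in>K. \<rho> w * \<Phi> w * \<mu> +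
        (2 * \<rho> w * \<Phi> w - 4 * \<Phi> w * \<Phi>' w) * \<mu> * ((z k)\<^sup>2 / S z))"
      unfolding dX2_def w_def[symmetric] x_def[symmetric] z_def[symmetric] \<mu>_def[symmetric]
      by (intro sum.cong refl) (simp add: algebra_simps)
    also have "\<dots> = n * (\<rho> w * \<Phi> w * \<mu>) + (2 * \<rho> w * \<Phi> w - 4 * \<Phi> w * \<Phi>' w) * \<mu>"
      by (simp only: sum.distrib sum_distrib_left[symmetric] \<open>_ = 1\<close>) (simp add: n_def)
    finally show ?thesis by (simp add: algebra_simps)
  qed
  have "((n + 2) * \<Phi> w + 4) * \<mu> \<le> ((n + 2) * l + 4) * M"
    using \<mu> \<Phi>0 \<Phi>l l0 by (intro mult_mono add_right_mono mult_left_mono) (auto simp: n_def)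
  also have "\<dots> \<le> 2 * A" using lM by (simp add: n_def A_def algebra_simps)
  finally have "\<rho> w * (((n + 2) * \<Phi> w + 4) * \<mu>) \<le> \<rho> w * (2 * A)"
    using \<rho>0 by (rule mult_left_mono)
  \<comment> \<open>All terms with \<open>\<Phi>'\<close> combine to
    \<open>- 4 * \<Phi>' w * (1 + \<Phi> w) * \<mu>\<close>, which monotonicity of \<phi> makes
    nonpositive.\<close>
  moreover have "0 \<le> \<Phi>' w * (1 + \<Phi> w) * \<mu>" using \<mu> \<Phi>0[of w] \<Phi>'0[of w] by simp
  ultimately show ?thesis unfolding s1 s2 by (simp add: algebra_simps)
next
  case False
  then show ?thesis by (simp add: dX1_def dX2_def \<rho>_def \<Phi>_def \<Phi>'_def)
qed

text \<open>Valid at every sample point: for positive \<open>W y\<close> the relation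
  \<open>W * S = q\<close> trades one factor \<open>r\<close> of \<open>r^2 * N\<close> for
  \<open>\<Phi> (W y)\<close>, and otherwise \<open>r = 0\<close>.\<close>

lemma loss_decomposition:
  "(\<Sum>i\<in>I. a i * (est y i - \<theta> i)\<^sup>2) = (\<Sum>i\<in>I. a i * (fst y i - \<theta> i)\<^sup>2)
    + ((\<Sum>i\<in>I. (fst y i - \<theta> i) * X1 i y) + (\<Sum>k\<in>K. snd y k * X2 k y))"
proof -
  define x z where "x = fst y" and "z = snd y"
  define r where "r = \<rho> (W y)"
  have "(\<Sum>k\<in>K. snd y k * X2 k y) = r * \<Phi> (W y) * (N x / q x) * S z"
    by (simp add: X2_def S_def sum_distrib_left sum_divide_distrib r_def x_def z_def power2_eq_square mult_ac)
  also have "\<dots> = r\<^sup>2 * N x"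
  proof (cases "0 < W y")
    case True
    then have qS: "q x > 0" "S z > 0"
      using q0[of x] S0[of z] by (auto simp: W_def x_def z_def zero_less_divide_iff)
    have "\<Phi> (W y) = r * W y"
      using True by (simp add: r_def \<rho>_def)
    then have "\<Phi> (W y) = r * (q x / S z)"
      by (simp add: W_def x_def z_def)
    then show ?thesis using qS by (simp add: field_simps power2_eq_square)
  next
    case False
    then show ?thesis by (simp add: r_def \<rho>_def \<Phi>_def)
  qed
  finally have 2: "(\<Sum>k\<in>K. snd y k * X2 k y) = r\<^sup>2 * N x" .
  have "(\<Sum>i\<in>I. a i * (est y i - \<theta> i)\<^sup>2) = (\<Sum>i\<in>I. a i * (x i - \<theta> i)\<^sup>2 +
      ((x i - \<theta> i) * X1 i y + r\<^sup>2 * (a i * (x i)\<^sup>2 / (c i)\<^sup>2)))"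
    using c by (intro sum.cong refl)
      (auto simp: est_def X1_def x_def r_def power2_eq_square field_simps less_imp_neq[symmetric])
  also have "\<dots> = (\<Sum>i\<in>I. a i * (x i - \<theta> i)\<^sup>2) + ((\<Sum>i\<in>I. (x i - \<theta> i) * X1 i y) + r\<^sup>2 * N x)"
    by (simp add: sum.distrib sum_distrib_left N_def)
  finally show ?thesis unfolding 2 x_def .
qed

end

section \<open>From the sign of the divergence to the comparison of risks\<close>

lemma AE_lborel_fun_coordinate_neq_0:
  assumes J: "finite J" and i: "i \<in> J"
  shows "AE x in lborel_fun J. x i \<noteq> 0"
proof (rule AE_I')
  interpret product_sigma_finite "\<lambda>_. lborel :: real measure" ..
  let ?A = "Pi\<^sub>E J (\<lambda>k. if k = i then {0} else UNIV)"
  have "emeasure (lborel_fun J) ?A = (\<Prod>k\<in>J. emeasure lborel (if k = i then {0 :: real} else UNIV))"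
    by (rule emeasure_PiM[OF J]) auto
  also have "\<dots> = 0"
    using J i by (intro prod_zero) auto
  finally show "?A \<in> null_sets (lborel_fun J)"
    using J by (intro null_setsI sets_PiM_I_finite) auto
  show "{x \<in> space (lborel_fun J). \<not> x i \<noteq> 0} \<subseteq> ?A"
  proof
    fix x assume "x \<in> {x \<in> space (lborel_fun J). \<not> x i \<noteq> 0}"
    then have "x \<in> extensional J" "x i = 0" by (auto simp: space_PiM PiE_iff)
    then show "x \<in> ?A" by (simp add: PiE_iff)
  qed
qed

text \<open>\<open>V m\<close> is not monotone along the coordinate lines, but \<open>B m * U m - V m\<close> is; comparing its
  integration by parts (\<open>\<epsilon> = 1\<close>) with that of \<open>B m * U m\<close> (\<open>\<epsilon> = 0\<close>) removes the linear part.\<close>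

lemma divergence_inequality:
  fixes U V D :: "'j \<Rightarrow> 'b \<Rightarrow> real" and B k :: "'j \<Rightarrow> real" and g :: "'b \<Rightarrow> real"
  assumes J: "finite J" and k: "\<And>m. m \<in> J \<Longrightarrow> 0 < k m" and B: "\<And>m. m \<in> J \<Longrightarrow> 0 \<le> B m"
    and D[measurable]: "\<And>m. m \<in> J \<Longrightarrow> D m \<in> borel_measurable M" and T[measurable]: "T \<in> borel_measurable M"
    and DB: "\<And>m y. m \<in> J \<Longrightarrow> D m y \<le> B m"
    and ibp: "\<And>m \<epsilon>. m \<in> J \<Longrightarrow> 0 \<le> \<epsilon> \<Longrightarrow> \<epsilon> \<le> 1 \<Longrightarrow> 
      0 \<le> (\<integral>y. U m y * (B m * U m y - \<epsilon> * V m y) * g y \<partial>M) \<and>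
      ennreal (\<integral>y. U m y * (B m * U m y - \<epsilon> * V m y) * g y \<partial>M) =
        (\<integral>\<^sup>+y. ennreal ((B m - \<epsilon> * D m y) / (2 * k m)) * T y \<partial>M)"
    and intU: "\<And>m. m \<in> J \<Longrightarrow> integrable M (\<lambda>y. U m y * U m y * g y)"
    and intV: "\<And>m. m \<in> J \<Longrightarrow> integrable M (\<lambda>y. U m y * V m y * g y)"
    and div: "\<And>y. (\<Sum>m\<in>J. D m y / k m) \<le> 0"
  shows "(\<integral>y. (\<Sum>m\<in>J. U m y * V m y) * g y \<partial>M) \<le> 0"
proof -
  define E where "E \<epsilon> m = (\<integral>y. U m y * (B m * U m y - \<epsilon> * V m y) * g y \<partial>M)" for \<epsilon> m
  have E: "E \<epsilon> m = B m * (\<integral>y. U m y * U m y * g y \<partial>M) - \<epsilon> * (\<integral>y. U m y * V m y * g y \<partial>M)"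
    if m: "m \<in> J" for \<epsilon> m
  proof -
    have "E \<epsilon> m = (\<integral>y. B m * (U m y * U m y * g y) - \<epsilon> * (U m y * V m y * g y) \<partial>M)"
      unfolding E_def by (intro Bochner_Integration.integral_cong) (auto simp: algebra_simps)
    then show ?thesis using intU[OF m] intV[OF m] by simp
  qed
  have sumE: "ennreal (\<Sum>m\<in>J. E \<epsilon> m) =
      (\<integral>\<^sup>+y. ennreal (\<Sum>m\<in>J. (B m - \<epsilon> * D m y) / (2 * k m)) * T y \<partial>M)" if "0 \<le> \<epsilon>" "\<epsilon> \<le> 1" for \<epsilon>
  proof -
    have nn: "0 \<le> (B m - \<epsilon> * D m y) / (2 * k m)" if m: "m \<in> J" for m y
    proof -
      have "\<epsilon> * D m y \<le> B m"
      proof (cases "D m y \<le> 0")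
        case True
        then have "\<epsilon> * D m y \<le> 0" using \<open>0 \<le> \<epsilon>\<close> by (simp add: mult_nonneg_nonpos)
        then show ?thesis using B[OF m] by linarith
      next
        case False
        then have "\<epsilon> * D m y \<le> 1 * D m y" using \<open>\<epsilon> \<le> 1\<close> by (intro mult_right_mono) auto
        then show ?thesis using DB[OF m, of y] by simp
      qed
      then show ?thesis using k[OF m] by simp
    qed
    have "ennreal (\<Sum>m\<in>J. E \<epsilon> m) = (\<Sum>m\<in>J. ennreal (E \<epsilon> m))"
      using ibp[OF _ that] unfolding E_def by (intro sum_ennreal[symmetric]) auto
    also have "\<dots> = (\<Sum>m\<in>J. \<integral>\<^sup>+y. ennreal ((B m - \<epsilon> * D m y) / (2 * k m)) * T y \<partial>M)"
      using ibp[OF _ that] unfolding E_def by (intro sum.cong) auto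
    also have "\<dots> = (\<integral>\<^sup>+y. (\<Sum>m\<in>J. ennreal ((B m - \<epsilon> * D m y) / (2 * k m)) * T y) \<partial>M)"
      by (rule nn_integral_sum[symmetric]) measurable
    also have "\<dots> = (\<integral>\<^sup>+y. ennreal (\<Sum>m\<in>J. (B m - \<epsilon> * D m y) / (2 * k m)) * T y \<partial>M)"
      using nn by (intro nn_integral_cong) (auto simp: sum_distrib_right[symmetric] sum_ennreal)
    finally show ?thesis .
  qed
  \<comment> \<open>The comparison is made only after summing over all coordinates, because the sign
    hypothesis concerns the whole divergence and not its single terms.\<close>
  have "ennreal (\<Sum>m\<in>J. E 0 m) \<le> ennreal (\<Sum>m\<in>J. E 1 m)"
    unfolding sumE[of 0, simplified] sumE[of 1, simplified]
  proof (intro nn_integral_mono mult_right_mono ennreal_leI)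
    fix y
    have "(\<Sum>m\<in>J. (B m - D m y) / (2 * k m)) = (\<Sum>m\<in>J. B m / (2 * k m)) - (\<Sum>m\<in>J. D m y / k m) / 2"
      by (simp add: diff_divide_distrib sum_subtractf sum_divide_distrib mult.commute)
    then show "(\<Sum>m\<in>J. B m / (2 * k m)) \<le> (\<Sum>m\<in>J. (B m - D m y) / (2 * k m))"
      using div[of y] by simp
  qed simp
  \<comment> \<open>\<open>ennreal\<close> sends negative numbers to 0, so this sign is needed to
    read the inequality back in the reals.\<close>
  moreover have "0 \<le> (\<Sum>m\<in>J. E 1 m)"
    using ibp[of _ 1] unfolding E_def by (intro sum_nonneg) auto
  ultimately have "(\<Sum>m\<in>J. E 0 m) \<le> (\<Sum>m\<in>J. E 1 m)" by (simp add: ennreal_le_iff)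
  then have "(\<Sum>m\<in>J. \<integral>y. U m y * V m y * g y \<partial>M) \<le> 0"
    by (simp add: E sum_subtractf)
  moreover have "(\<integral>y. (\<Sum>m\<in>J. U m y * V m y) * g y \<partial>M) = (\<Sum>m\<in>J. \<integral>y. U m y * V m y * g y \<partial>M)"
    unfolding sum_distrib_right using intV by (rule Bochner_Integration.integral_sum)
  ultimately show ?thesis by simp
qed

context shrinkage
begin

definition "Q \<theta> \<sigma> y = ((\<Sum>i\<in>I. (fst y i - \<theta> i)\<^sup>2 / d i) + S (snd y)) / \<sigma>\<^sup>2"

lemma measurable_Q[measurable]: "Q \<theta> \<sigma> \<in> borel_measurable \<MM>"
  unfolding Q_def[abs_def] by measurable

lemma Q0: "0 \<le> Q \<theta> \<sigma> y"
  unfolding Q_def using d S0 by (intro divide_nonneg_nonneg add_nonneg_nonneg sum_nonneg) (auto simp: less_imp_le)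

lemma Q_coordinate1:
  assumes i: "i \<in> I" and \<sigma>: "0 < \<sigma>" and b: "Q \<theta> \<sigma> y \<le> b"
  shows "(fst y i - \<theta> i)\<^sup>2 \<le> d i * \<sigma>\<^sup>2 * b"
proof -
  have "(fst y i - \<theta> i)\<^sup>2 / d i \<le> (\<Sum>i\<in>I. (fst y i - \<theta> i)\<^sup>2 / d i)"
    using i I d by (intro member_le_sum) (auto simp: less_imp_le)
  also have "\<dots> \<le> \<sigma>\<^sup>2 * b" using b \<sigma> S0[of "snd y"] by (simp add: Q_def field_simps)
  finally show ?thesis using d[OF i] by (simp add: field_simps)
qed

lemma Q_coordinate2:
  assumes k: "k \<in> K" and \<sigma>: "0 < \<sigma>" and b: "Q \<theta> \<sigma> y \<le> b"
  shows "(snd y k)\<^sup>2 \<le> \<sigma>\<^sup>2 * b"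
proof -
  have "(snd y k)\<^sup>2 \<le> S (snd y)"
    unfolding S_def using k K by (intro member_le_sum) auto
  moreover have "0 \<le> (\<Sum>i\<in>I. (fst y i - \<theta> i)\<^sup>2 / d i)"
    using d by (intro sum_nonneg) (auto simp: less_imp_le)
  ultimately show ?thesis using b \<sigma> by (simp add: Q_def field_simps)
qed

text \<open>\<open>B\<close> is the upper bound on \<open>dX1 i\<close>, hence
  \<open>B * (x i - \<theta> i) - \<epsilon> * X1 i\<close> is nondecreasing on the line for every
  \<epsilon> in [0, 1]. The coefficient of the squared coordinate in the radial variable is
  \<open>1 / (d i * \<sigma>^2)\<close>.\<close>

lemma ibp_first_block:
  fixes f :: "real \<Rightarrow> real"
  assumes i: "i \<in> I" and \<sigma>: "0 < \<sigma>" and \<epsilon>: "0 \<le> \<epsilon>" "\<epsilon> \<le> 1"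
    and f[measurable]: "f \<in> borel_measurable borel" and f0: "\<And>s. 0 \<le> f s"
    and B: "B = 4 * (a i / c i) * v"
    and int: "integrable \<MM> (\<lambda>y. (fst y i - \<theta> i) * (B * (fst y i - \<theta> i) - \<epsilon> * X1 i y) * f (Q \<theta> \<sigma> y))"
  shows "0 \<le> (\<integral>y. (fst y i - \<theta> i) * (B * (fst y i - \<theta> i) - \<epsilon> * X1 i y) * f (Q \<theta> \<sigma> y) \<partial>\<MM>) \<and>
     ennreal (\<integral>y. (fst y i - \<theta> i) * (B * (fst y i - \<theta> i) - \<epsilon> * X1 i y) * f (Q \<theta> \<sigma> y) \<partial>\<MM>) =
     (\<integral>\<^sup>+y. ennreal ((B - \<epsilon> * dX1 i y) / (2 * (1 / (d i * \<sigma>\<^sup>2)))) * tail_integral f (Q \<theta> \<sigma> y) \<partial>\<MM>)"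
proof -
  let ?N = "lborel_fun (I - {i}) \<Otimes>\<^sub>M lborel_fun K"
  let ?e = "\<lambda>((x, z), t). (x(i := t), z)"
  let ?R = "\<lambda>w. ((\<Sum>i'\<in>I - {i}. (fst w i' - \<theta> i')\<^sup>2 / d i') + S (snd w)) / \<sigma>\<^sup>2"
  have fin: "finite (I - {i})" using I by simp
  interpret P: pair_sigma_finite "lborel_fun (I - {i})" "lborel_fun K"
    by (rule pair_sigma_finite_lborel_fun) (use fin K in auto)
  \<comment> \<open>For almost all values of the other coordinates the one at \<open>i0\<close> is
    nonzero; the lines where it vanishes are discarded.\<close>
  have "\<not> card I \<le> card {i}" using I2 by simp
  then obtain i0 where i0: "i0 \<in> I - {i}" using card_mono[of "{i}" I] by blast
  have B0: "0 \<le> B" unfolding B using a[OF i] c[OF i] v0 by simp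
  have AE: "AE w in ?N. fst w i0 \<noteq> 0"
  proof (rule P.AE_pair_measure)
    show "{w \<in> space ?N. fst w i0 \<noteq> 0} \<in> sets ?N" using i0 by measurable
    show "AE x in lborel_fun (I - {i}). AE z in lborel_fun K. fst (x, z) i0 \<noteq> 0"
      using AE_lborel_fun_coordinate_neq_0[OF fin i0] by eventually_elim simp
  qed
  have "(\<lambda>y. B * (fst y i - \<theta> i) - \<epsilon> * X1 i y) \<in> borel_measurable \<MM>"
    "(\<lambda>y. B - \<epsilon> * dX1 i y) \<in> borel_measurable \<MM>" "(\<lambda>y. fst y i - \<theta> i) \<in> borel_measurable \<MM>"
    using i by measurable
  note ibp = integration_by_parts_coordinate[OF
      sigma_finite_lborel_fun_pair[OF fin K] measurable_split_fst[OF i] distr_split_fst[OF I K i]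
      f f0 _ this(1,2) measurable_Q[of \<theta> \<sigma>] this(3), where k = "1 / (d i * \<sigma>\<^sup>2)" and \<eta> = "\<theta> i" and R = ?R]
  have 1: "0 < 1 / (d i * \<sigma>\<^sup>2)" using d[OF i] \<sigma> by simp
  have 2: "fst (?e (w, t)) i - \<theta> i = t - \<theta> i" if "w \<in> space ?N" for w t
    by (simp add: case_prod_beta')
  have 3: "Q \<theta> \<sigma> (?e (w, t)) = 1 / (d i * \<sigma>\<^sup>2) * (t - \<theta> i)\<^sup>2 + ?R w" if "w \<in> space ?N" for w t
  proof -
    have "(\<Sum>i'\<in>I. (((fst w)(i := t)) i' - \<theta> i')\<^sup>2 / d i') =
        (t - \<theta> i)\<^sup>2 / d i + (\<Sum>i'\<in>I - {i}. (fst w i' - \<theta> i')\<^sup>2 / d i')"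
      using I i by (subst sum.remove[of _ i]) (auto intro!: sum.cong)
    then show ?thesis by (simp add: Q_def case_prod_beta' add_divide_distrib)
  qed
  have 4: "AE w in ?N. \<forall>t. ((\<lambda>t. B * (fst (?e (w, t)) i - \<theta> i) - \<epsilon> * X1 i (?e (w, t)))
      has_real_derivative B - \<epsilon> * dX1 i (?e (w, t))) (at t)"
    using AE
  proof eventually_elim
    case (elim w)
    show ?case
    proof
      fix t
      show "((\<lambda>t. B * (fst (?e (w, t)) i - \<theta> i) - \<epsilon> * X1 i (?e (w, t)))
        has_real_derivative B - \<epsilon> * dX1 i (?e (w, t))) (at t)"
        unfolding case_prod_beta' fst_conv snd_conv fun_upd_same
        by (intro DERIV_diff DERIV_cmult has_derivative_X1[where x = "fst w", OF i i0 elim])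
          (auto intro!: derivative_eq_intros)
    qed
  qed
  have 5: "0 \<le> B - \<epsilon> * dX1 i y" for y
  proof -
    have "\<epsilon> * dX1 i y \<le> \<epsilon> * B" using dX1_le[OF i, of y] \<epsilon> B by (intro mult_left_mono) auto
    also have "\<dots> \<le> 1 * B" using \<epsilon> B0 by (intro mult_right_mono)
    finally show ?thesis by simp
  qed
  show ?thesis
    using ibp[OF 1 2 3 4 5 int] by simp
qed

text \<open>No line is discarded: the second field is differentiable on every line, including those
  through \<open>z = 0\<close>.\<close>

lemma ibp_second_block:
  fixes f :: "real \<Rightarrow> real"
  assumes k: "k \<in> K" and \<sigma>: "0 < \<sigma>" and \<epsilon>: "0 \<le> \<epsilon>" "\<epsilon> \<le> 1"
    and f[measurable]: "f \<in> borel_measurable borel" and f0: "\<And>s. 0 \<le> f s"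
    and B: "B = 3 * v * l * M"
    and int: "integrable \<MM> (\<lambda>y. snd y k * (B * snd y k - \<epsilon> * X2 k y) * f (Q \<theta> \<sigma> y))"
  shows "0 \<le> (\<integral>y. snd y k * (B * snd y k - \<epsilon> * X2 k y) * f (Q \<theta> \<sigma> y) \<partial>\<MM>) \<and>
     ennreal (\<integral>y. snd y k * (B * snd y k - \<epsilon> * X2 k y) * f (Q \<theta> \<sigma> y) \<partial>\<MM>) =
     (\<integral>\<^sup>+y. ennreal ((B - \<epsilon> * dX2 k y) / (2 * (1 / \<sigma>\<^sup>2))) * tail_integral f (Q \<theta> \<sigma> y) \<partial>\<MM>)"
proof -
  let ?N = "lborel_fun I \<Otimes>\<^sub>M lborel_fun (K - {k})"
  let ?e = "\<lambda>((x, z), t). (x, z(k := t))"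
  let ?R = "\<lambda>w. ((\<Sum>i\<in>I. (fst w i - \<theta> i)\<^sup>2 / d i) + (\<Sum>k'\<in>K - {k}. (snd w k')\<^sup>2)) / \<sigma>\<^sup>2"
  have fin: "finite (K - {k})" using K by simp
  have B0: "0 \<le> B" unfolding B using v0 l0 M0 by simp
  have "(\<lambda>y. B * snd y k - \<epsilon> * X2 k y) \<in> borel_measurable \<MM>"
    "(\<lambda>y. B - \<epsilon> * dX2 k y) \<in> borel_measurable \<MM>" "(\<lambda>y. snd y k) \<in> borel_measurable \<MM>"
    using k by measurable
  note ibp = integration_by_parts_coordinate[OF
      sigma_finite_lborel_fun_pair[OF I fin] measurable_split_snd[OF k] distr_split_snd[OF I K k]
      f f0 _ this(1,2) measurable_Q[of \<theta> \<sigma>] this(3), where k = "1 / \<sigma>\<^sup>2" and \<eta> = 0 and R = ?R]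
  have 1: "0 < 1 / \<sigma>\<^sup>2" using \<sigma> by simp
  have 2: "snd (?e (w, t)) k = t - 0" if "w \<in> space ?N" for w t
    by (simp add: case_prod_beta')
  have 3: "Q \<theta> \<sigma> (?e (w, t)) = 1 / \<sigma>\<^sup>2 * (t - 0)\<^sup>2 + ?R w" if "w \<in> space ?N" for w t
    using S_upd[OF k, of "snd w" t] by (simp add: Q_def case_prod_beta' add_divide_distrib)
  have 4: "AE w in ?N. \<forall>t. ((\<lambda>t. B * snd (?e (w, t)) k - \<epsilon> * X2 k (?e (w, t)))
      has_real_derivative B - \<epsilon> * dX2 k (?e (w, t))) (at t)"
  proof (intro AE_I2 allI)
    fix w t
    show "((\<lambda>t. B * snd (?e (w, t)) k - \<epsilon> * X2 k (?e (w, t)))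
      has_real_derivative B - \<epsilon> * dX2 k (?e (w, t))) (at t)"
      unfolding case_prod_beta' fst_conv snd_conv fun_upd_same
      by (intro DERIV_diff DERIV_cmult has_derivative_X2[OF k])
        (auto intro!: derivative_eq_intros)
  qed
  have 5: "0 \<le> B - \<epsilon> * dX2 k y" for y
  proof -
    have "\<epsilon> * dX2 k y \<le> \<epsilon> * B" using dX2_le[OF k, of y] \<epsilon> B by (intro mult_left_mono) auto
    also have "\<dots> \<le> 1 * B" using \<epsilon> B0 by (intro mult_right_mono)
    finally show ?thesis by simp
  qed
  show ?thesis
    using ibp[OF 1 2 3 4 5 int] by simp
qed

text \<open>On the support of the kernel all centred coordinates are bounded, so the products of
  coordinates and fields are integrable and the two risks may be subtracted as real numbers.\<close>

lemma risk_le_bounded_support: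
  fixes f :: "real \<Rightarrow> real"
  assumes \<sigma>: "0 < \<sigma>" and f[measurable]: "f \<in> borel_measurable borel" and f0: "\<And>s. 0 \<le> f s"
    and supp: "\<And>s. b < s \<Longrightarrow> f s = 0" and intf: "integrable \<MM> (\<lambda>y. f (Q \<theta> \<sigma> y))"
  shows "(\<integral>\<^sup>+y. ennreal (\<Sum>i\<in>I. a i * (est y i - \<theta> i)\<^sup>2) * ennreal (f (Q \<theta> \<sigma> y)) \<partial>\<MM>) \<le>
         (\<integral>\<^sup>+y. ennreal (\<Sum>i\<in>I. a i * (fst y i - \<theta> i)\<^sup>2) * ennreal (f (Q \<theta> \<sigma> y)) \<partial>\<MM>)"
proof -
  have int: "integrable \<MM> (\<lambda>y. h y * f (Q \<theta> \<sigma> y))"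
    if [measurable]: "h \<in> borel_measurable \<MM>" and C: "\<And>y. Q \<theta> \<sigma> y \<le> b \<Longrightarrow> \<bar>h y\<bar> \<le> C" for h C
  proof (rule Bochner_Integration.integrable_bound[OF integrable_mult_right[OF intf, of C]])
    show "AE y in \<MM>. norm (h y * f (Q \<theta> \<sigma> y)) \<le> norm (C * f (Q \<theta> \<sigma> y))"
    proof (rule AE_I2)
      fix y
      show "norm (h y * f (Q \<theta> \<sigma> y)) \<le> norm (C * f (Q \<theta> \<sigma> y))"
      proof (cases "Q \<theta> \<sigma> y \<le> b")
        case True
        then have "\<bar>h y\<bar> \<le> \<bar>C\<bar>" using C[of y] by linarith
        then show ?thesis by (auto simp: abs_mult intro!: mult_right_mono)
      qed (simp add: supp)
    qed
  qed measurable
  \<comment> \<open>The disjoint sum of the index sets joins both blocks into one field;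
    \<open>\<kappa>\<close> collects the coefficients of the squares in \<open>Q\<close>.\<close>
  define J where "J = I <+> K"
  define U :: "'i + 'k \<Rightarrow> ('i \<Rightarrow> real) \<times> ('k \<Rightarrow> real) \<Rightarrow> real"
    where "U = case_sum (\<lambda>i y. fst y i - \<theta> i) (\<lambda>k y. snd y k)"
  define V where "V = case_sum X1 X2"
  define D where "D = case_sum dX1 dX2"
  define B :: "'i + 'k \<Rightarrow> real" where "B = case_sum (\<lambda>i. 4 * (a i / c i) * v) (\<lambda>_. 3 * v * l * M)"
  define \<kappa> :: "'i + 'k \<Rightarrow> real" where "\<kappa> = case_sum (\<lambda>i. 1 / (d i * \<sigma>\<^sup>2)) (\<lambda>_. 1 / \<sigma>\<^sup>2)"
  note defs = J_def U_def V_def D_def B_def \<kappa>_def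
  have measU[measurable]: "U m \<in> borel_measurable \<MM>" if "m \<in> J" for m
    using that by (auto simp: defs)
  have measV[measurable]: "V m \<in> borel_measurable \<MM>" if "m \<in> J" for m
    using that by (auto simp: defs)
  have measD[measurable]: "D m \<in> borel_measurable \<MM>" if "m \<in> J" for m
    using that by (auto simp: defs)
  have intU: "integrable \<MM> (\<lambda>y. U m y * U m y * f (Q \<theta> \<sigma> y))" if m: "m \<in> J" for m
  proof (cases m)
    case (Inl i)
    with m have i: "i \<in> I" by (auto simp: J_def)
    show ?thesis
      by (rule int[of _ "d i * \<sigma>\<^sup>2 * b"])
        (use Q_coordinate1[OF i \<sigma>] measU[OF m] in \<open>auto simp: U_def Inl power2_eq_square\<close>)
  next
    case (Inr k)
    with m have k: "k \<in> K" by (auto simp: J_def)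
    show ?thesis
      by (rule int[of _ "\<sigma>\<^sup>2 * b"])
        (use Q_coordinate2[OF k \<sigma>] measU[OF m] in \<open>auto simp: U_def Inr power2_eq_square\<close>)
  qed
  have intV: "integrable \<MM> (\<lambda>y. U m y * V m y * f (Q \<theta> \<sigma> y))" if m: "m \<in> J" for m
  proof (cases m)
    case (Inl i)
    with m have i: "i \<in> I" by (auto simp: J_def)
    have "\<bar>U m y * V m y\<bar> \<le> 2 * (a i / c i) * v * (2 * (d i * \<sigma>\<^sup>2 * b) + (\<theta> i)\<^sup>2)" if "Q \<theta> \<sigma> y \<le> b" for y
    proof -
      define u where "u = fst y i - \<theta> i"
      \<comment> \<open>The field contains \<open>x i\<close>, whereas the support bounds
        \<open>u = x i - \<theta> i\<close>. With \<open>x i = u + \<theta> i\<close> the mixed term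
        is absorbed by the squares of \<open>u \<plusminus> \<theta> i / 2\<close>.\<close>
      have "\<bar>u * fst y i\<bar> \<le> 2 * u\<^sup>2 + (\<theta> i)\<^sup>2"
      proof -
        define s where "s = \<theta> i"
        have "0 \<le> u * u - u * s + s * s / 4" "0 \<le> u * u + u * s + s * s / 4"
          using zero_le_square[of "u - s / 2"] zero_le_square[of "u + s / 2"]
          by (simp_all add: algebra_simps)
        moreover have "0 \<le> u * u" "0 \<le> s * s" by simp_all
        ultimately have "\<bar>u * u + u * s\<bar> \<le> 2 * (u * u) + s * s"
          by linarith
        moreover have "u * fst y i = u * u + u * s" by (simp add: u_def s_def algebra_simps)
        ultimately show ?thesis by (simp add: power2_eq_square s_def)
      qed
      then have "\<bar>u * fst y i\<bar> \<le> 2 * (d i * \<sigma>\<^sup>2 * b) + (\<theta> i)\<^sup>2"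
        using Q_coordinate1[OF i \<sigma> that] by (simp add: u_def)
      then have "2 * (a i / c i) * \<rho> (W y) * \<bar>u * fst y i\<bar> \<le>
          2 * (a i / c i) * v * (2 * (d i * \<sigma>\<^sup>2 * b) + (\<theta> i)\<^sup>2)"
        using a[OF i] c[OF i] \<rho>0 \<rho>v v0 by (intro mult_mono) auto
      moreover have "\<bar>U m y * V m y\<bar> = 2 * (a i / c i) * \<rho> (W y) * \<bar>u * fst y i\<bar>"
        using a[OF i] c[OF i] \<rho>0[of "W y"] by (simp add: U_def V_def Inl X1_def abs_mult u_def)
      ultimately show ?thesis by simp
    qed
    then show ?thesis using measU[OF m] measV[OF m] by (intro int) auto
  next
    case (Inr k)
    with m have k: "k \<in> K" by (auto simp: J_def)
    have "\<bar>U m y * V m y\<bar> \<le> \<sigma>\<^sup>2 * b * (v * l) * M" if "Q \<theta> \<sigma> y \<le> b" for y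
    proof -
      have 0: "0 \<le> \<sigma>\<^sup>2 * b" using Q0[of \<theta> \<sigma> y] that by auto
      have "U m y * V m y = (snd y k)\<^sup>2 * (\<rho> (W y) * \<Phi> (W y)) * (N (fst y) / q (fst y))"
        by (simp add: U_def V_def Inr X2_def power2_eq_square mult.assoc)
      moreover have "0 \<le> \<dots>"
        by (intro mult_nonneg_nonneg zero_le_power2 \<rho>0 \<Phi>0 Nq0)
      ultimately have "\<bar>U m y * V m y\<bar> = (snd y k)\<^sup>2 * (\<rho> (W y) * \<Phi> (W y)) * (N (fst y) / q (fst y))"
        by (simp only: abs_of_nonneg)
      also have "\<dots> \<le> \<sigma>\<^sup>2 * b * (v * l) * M"
        by (intro mult_mono Q_coordinate2[OF k \<sigma> that] \<rho>v \<Phi>l Nq_le v0 l0 Nq0 \<rho>0 \<Phi>0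
            mult_nonneg_nonneg[OF v0 l0] mult_nonneg_nonneg[OF \<rho>0 \<Phi>0] mult_nonneg_nonneg[OF 0] 0)
      finally show ?thesis .
    qed
    then show ?thesis using measU[OF m] measV[OF m] by (intro int) auto
  qed
  have UV: "(\<integral>y. (\<Sum>m\<in>J. U m y * V m y) * f (Q \<theta> \<sigma> y) \<partial>\<MM>) \<le> 0"
  proof (rule divergence_inequality[where B = B and k = \<kappa> and D = D and T = "\<lambda>y. tail_integral f (Q \<theta> \<sigma> y)"])
    show "finite J" using I K by (simp add: J_def)
    show "0 < \<kappa> m" if "m \<in> J" for m using that d \<sigma> by (auto simp: defs)
    show "0 \<le> B m" if "m \<in> J" for m
      using that a c v0 l0 M0 by (auto simp: defs less_imp_le intro!: divide_nonneg_nonneg mult_nonneg_nonneg)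
    show "D m y \<le> B m" if "m \<in> J" for m y using that dX1_le[of _ y] dX2_le[of _ y] by (auto simp: defs)
    show "(\<Sum>m\<in>J. D m y / \<kappa> m) \<le> 0" for y
    proof -
      have "(\<Sum>m\<in>J. D m y / \<kappa> m) = \<sigma>\<^sup>2 * ((\<Sum>i\<in>I. d i * dX1 i y) + (\<Sum>k\<in>K. dX2 k y))"
        unfolding J_def sum.Plus[OF I K] by (simp add: D_def \<kappa>_def distrib_left sum_distrib_left mult_ac)
      then show ?thesis using divergence_le_0[of y] by (simp add: mult_nonneg_nonpos)
    qed
    fix m and \<epsilon> :: real
    assume m: "m \<in> J" and \<epsilon>: "0 \<le> \<epsilon>" "\<epsilon> \<le> 1"
    have "integrable \<MM> (\<lambda>y. B m * (U m y * U m y * f (Q \<theta> \<sigma> y)) - \<epsilon> * (U m y * V m y * f (Q \<theta> \<sigma> y)))"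
      using intU[OF m] intV[OF m] by simp
    then have i: "integrable \<MM> (\<lambda>y. U m y * (B m * U m y - \<epsilon> * V m y) * f (Q \<theta> \<sigma> y))"
      by (simp add: algebra_simps)
    show "0 \<le> (\<integral>y. U m y * (B m * U m y - \<epsilon> * V m y) * f (Q \<theta> \<sigma> y) \<partial>\<MM>) \<and>
      ennreal (\<integral>y. U m y * (B m * U m y - \<epsilon> * V m y) * f (Q \<theta> \<sigma> y) \<partial>\<MM>) =
        (\<integral>\<^sup>+y. ennreal ((B m - \<epsilon> * D m y) / (2 * \<kappa> m)) * tail_integral f (Q \<theta> \<sigma> y) \<partial>\<MM>)"
    proof (cases m)
      case (Inl i)
      with m have "i \<in> I" by (auto simp: J_def)
      from ibp_first_block[OF this \<sigma> \<epsilon> f f0 refl i[unfolded Inl U_def V_def B_def sum.case]]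
      show ?thesis by (simp only: Inl U_def V_def B_def D_def \<kappa>_def sum.case)
    next
      case (Inr k)
      with m have "k \<in> K" by (auto simp: J_def)
      from ibp_second_block[OF this \<sigma> \<epsilon> f f0 refl i[unfolded Inr U_def V_def B_def sum.case]]
      show ?thesis by (simp only: Inr U_def V_def B_def D_def \<kappa>_def sum.case)
    qed
  qed (use measD intU intV in auto)
  define L where "L y = (\<Sum>i\<in>I. a i * (fst y i - \<theta> i)\<^sup>2)" for y :: "('i \<Rightarrow> real) \<times> ('k \<Rightarrow> real)"
  define L' where "L' y = (\<Sum>i\<in>I. a i * (est y i - \<theta> i)\<^sup>2)" for y
  have L0: "0 \<le> L y" "0 \<le> L' y" for y
    unfolding L_def L'_def using a by (auto intro!: sum_nonneg)
  have L': "L' y = L y + (\<Sum>m\<in>J. U m y * V m y)" for y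
    unfolding L_def L'_def J_def sum.Plus[OF I K] loss_decomposition by (simp add: U_def V_def)
  have iL: "integrable \<MM> (\<lambda>y. L y * f (Q \<theta> \<sigma> y))"
  proof -
    have "integrable \<MM> (\<lambda>y. \<Sum>i\<in>I. a i * (U (Inl i) y * U (Inl i) y * f (Q \<theta> \<sigma> y)))"
      by (intro Bochner_Integration.integrable_sum integrable_mult_right intU) (auto simp: J_def)
    then show ?thesis
      by (simp add: L_def U_def power2_eq_square sum_distrib_right mult.assoc)
  qed
  have iUV: "integrable \<MM> (\<lambda>y. (\<Sum>m\<in>J. U m y * V m y) * f (Q \<theta> \<sigma> y))"
    unfolding sum_distrib_right by (intro Bochner_Integration.integrable_sum intV)
  have iL': "integrable \<MM> (\<lambda>y. L' y * f (Q \<theta> \<sigma> y))"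
    unfolding L' distrib_right using iL iUV by (rule Bochner_Integration.integrable_add)
  have eq: "(\<integral>\<^sup>+y. ennreal (h y) * ennreal (f (Q \<theta> \<sigma> y)) \<partial>\<MM>) = ennreal (\<integral>y. h y * f (Q \<theta> \<sigma> y) \<partial>\<MM>)"
    if "integrable \<MM> (\<lambda>y. h y * f (Q \<theta> \<sigma> y))" "\<And>y. 0 \<le> h y" for h
    using nn_integral_eq_integral[OF that(1)] that(2) f0 by (simp add: ennreal_mult)
  have "(\<integral>y. L' y * f (Q \<theta> \<sigma> y) \<partial>\<MM>) \<le> (\<integral>y. L y * f (Q \<theta> \<sigma> y) \<partial>\<MM>)"
    unfolding L' distrib_right using UV Bochner_Integration.integral_add[OF iL iUV] by simp
  then show ?thesis
    unfolding L_def[symmetric] L'_def[symmetric] eq[OF iL L0(1)] eq[OF iL' L0(2)] by (rule ennreal_leI)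
qed

text \<open>Truncating \<open>f\<close> in its radial argument keeps the density a function of
  \<open>Q\<close>. It is then no longer normalised, which is why the bounded case asks only for
  integrability.\<close>

theorem risk_le:
  fixes f :: "real \<Rightarrow> real"
  assumes \<sigma>: "0 < \<sigma>" and f[measurable]: "f \<in> borel_measurable borel" and f0: "\<And>s. 0 \<le> f s"
    and fin: "(\<integral>\<^sup>+y. ennreal (f (Q \<theta> \<sigma> y)) \<partial>\<MM>) < \<infinity>"
  shows "(\<integral>\<^sup>+y. ennreal (\<Sum>i\<in>I. a i * (est y i - \<theta> i)\<^sup>2) * ennreal (f (Q \<theta> \<sigma> y)) \<partial>\<MM>) \<le>
         (\<integral>\<^sup>+y. ennreal (\<Sum>i\<in>I. a i * (fst y i - \<theta> i)\<^sup>2) * ennreal (f (Q \<theta> \<sigma> y)) \<partial>\<MM>)"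
proof -
  define g where "g m s = (if s \<le> real m then f s else 0)" for m :: nat and s
  have [measurable]: "g m \<in> borel_measurable borel" for m unfolding g_def[abs_def] by measurable
  have g0: "0 \<le> g m s" and gf: "g m s \<le> f s" for m s using f0 by (auto simp: g_def)
  have [measurable]: "(\<lambda>y. \<Sum>i\<in>I. a i * (est y i - \<theta> i)\<^sup>2) \<in> borel_measurable \<MM>"
    by (intro borel_measurable_sum borel_measurable_times borel_measurable_power borel_measurable_diff
        measurable_est measurable_const) auto
  have intf: "integrable \<MM> (\<lambda>y. f (Q \<theta> \<sigma> y))"
    using fin f0 by (intro integrableI_nonneg) auto
  let ?L' = "\<lambda>y. ennreal (\<Sum>i\<in>I. a i * (est y i - \<theta> i)\<^sup>2)"
  let ?L = "\<lambda>y. ennreal (\<Sum>i\<in>I. a i * (fst y i - \<theta> i)\<^sup>2)"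
  have "(\<integral>\<^sup>+y. ?L' y * ennreal (f (Q \<theta> \<sigma> y)) \<partial>\<MM>) \<le>
      (\<integral>\<^sup>+y. (SUP m. ?L' y * ennreal (g m (Q \<theta> \<sigma> y))) \<partial>\<MM>)"
  proof (rule nn_integral_mono)
    fix y
    obtain m where "Q \<theta> \<sigma> y \<le> real m" using real_arch_simple by blast
    then have "?L' y * ennreal (f (Q \<theta> \<sigma> y)) = ?L' y * ennreal (g m (Q \<theta> \<sigma> y))" by (simp add: g_def)
    also have "\<dots> \<le> (SUP m. ?L' y * ennreal (g m (Q \<theta> \<sigma> y)))" by (rule SUP_upper) simp
    finally show "?L' y * ennreal (f (Q \<theta> \<sigma> y)) \<le> (SUP m. ?L' y * ennreal (g m (Q \<theta> \<sigma> y)))" .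
  qed
  also have "\<dots> = (SUP m. \<integral>\<^sup>+y. ?L' y * ennreal (g m (Q \<theta> \<sigma> y)) \<partial>\<MM>)"
  proof (rule nn_integral_monotone_convergence_SUP)
    show "incseq (\<lambda>m y. ?L' y * ennreal (g m (Q \<theta> \<sigma> y)))"
      by (intro incseq_SucI le_funI mult_left_mono ennreal_leI) (auto simp: g_def f0)
  qed measurable
  also have "\<dots> \<le> (\<integral>\<^sup>+y. ?L y * ennreal (f (Q \<theta> \<sigma> y)) \<partial>\<MM>)"
  proof (rule SUP_least)
    fix m
    have "integrable \<MM> (\<lambda>y. g m (Q \<theta> \<sigma> y))"
      by (rule Bochner_Integration.integrable_bound[OF intf]) (use g0 gf f0 in auto)
    then have "(\<integral>\<^sup>+y. ?L' y * ennreal (g m (Q \<theta> \<sigma> y)) \<partial>\<MM>) \<le>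
        (\<integral>\<^sup>+y. ?L y * ennreal (g m (Q \<theta> \<sigma> y)) \<partial>\<MM>)"
      using g0 by (intro risk_le_bounded_support[where b = "real m"] \<sigma>) (auto simp: g_def)
    also have "\<dots> \<le> (\<integral>\<^sup>+y. ?L y * ennreal (f (Q \<theta> \<sigma> y)) \<partial>\<MM>)"
      using gf by (intro nn_integral_mono mult_left_mono ennreal_leI) auto
    finally show "(\<integral>\<^sup>+y. ?L' y * ennreal (g m (Q \<theta> \<sigma> y)) \<partial>\<MM>) \<le>
        (\<integral>\<^sup>+y. ?L y * ennreal (f (Q \<theta> \<sigma> y)) \<partial>\<MM>)" .
  qed
  finally show ?thesis .
qed

end

section \<open>Condition number\<close>

text \<open>Each ratio is compared in the cross-multiplied form
  \<open>e i * d p \<le> d 1 * e k\<close>. On the indices up to \<open>p - 1\<close> both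
  \<open>d\<close> and \<open>c\<close> decrease, hence so does \<open>e\<close>; the maximum is at
  1 or \<open>p\<close>, the minimum at \<open>p - 1\<close> or \<open>p\<close>. Of these four
  cases the two with minimum at \<open>p - 1\<close> are the two fractions of
  \<open>v_minus\<close>, and those with minimum at \<open>p\<close> follow from
  \<open>c 1 < c p\<close> and \<open>d p \<le> d 1\<close>.\<close>

lemma condition_number_le:
  fixes d c :: "nat \<Rightarrow> real" and p :: nat and t :: real
  assumes p: "2 \<le> p" and d_anti: "\<And>i k. 1 \<le> i \<Longrightarrow> i \<le> k \<Longrightarrow> k \<le> p \<Longrightarrow> d k \<le> d i" and dp: "0 < d p"
    and c_anti: "\<And>i k. 1 \<le> i \<Longrightarrow> i \<le> k \<Longrightarrow> k \<le> p - 1 \<Longrightarrow> c k \<le> c i" and c0: "0 < c (p - 1)"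
    and cp: "c 1 < c p" and t0: "0 \<le> t" and t: "t \<le> v_minus p d c"
  shows "0 < Min ((\<lambda>i. d i * (1 - t / c i)) ` {1..p})"
    and "Max ((\<lambda>i. d i * (1 - t / c i)) ` {1..p}) / Min ((\<lambda>i. d i * (1 - t / c i)) ` {1..p}) \<le> d 1 / d p"
proof -
  define e where "e i = d i * (1 - t / c i)" for i
  let ?q = "p - 1"
  have dq: "d p \<le> d ?q" "d ?q \<le> d 1" and cq: "c ?q \<le> c 1"
    using p by (auto intro!: d_anti c_anti)
  have pos: "0 < d 1" "0 < d ?q" "0 < c 1" "0 < c p" "c ?q < c p"
    using dq dp cq c0 cp by auto
  have dd: "(d p)\<^sup>2 \<le> d 1 * d ?q"
    using dq dp pos by (auto simp: power2_eq_square intro!: mult_mono)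
  have den2: "0 < c p * d 1 * d ?q - c ?q * (d p)\<^sup>2"
  proof -
    have "c ?q * (d p)\<^sup>2 < c p * (d p)\<^sup>2" using pos dp by simp
    also have "\<dots> \<le> c p * (d 1 * d ?q)" using dd pos by (intro mult_left_mono) auto
    finally show ?thesis by (simp add: mult.assoc)
  qed
  have t2: "t * (c p * d 1 * d ?q - c ?q * (d p)\<^sup>2) \<le> c ?q * c p * (d 1 * d ?q - (d p)\<^sup>2)"
  proof -
    have "t \<le> c ?q * c p * (d 1 * d ?q - (d p)\<^sup>2) / (c p * d 1 * d ?q - c ?q * (d p)\<^sup>2)"
      using t by (simp add: v_minus_def)
    then show ?thesis using den2 by (simp only: pos_le_divide_eq)
  qed
  have t1: "t * (c 1 * d ?q - c ?q * d p) \<le> c 1 * c ?q * (d ?q - d p)"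
  proof -
    have tv: "t \<le> c 1 * c ?q * (d ?q - d p) / (c 1 * d ?q - c ?q * d p)"
      using t by (simp add: v_minus_def)
    \<comment> \<open>The denominator of the first fraction vanishes if \<open>c 1 = c ?q\<close>
      and \<open>d ?q = d p\<close>; in that case the claim only needs a nonnegative right-hand
      side.\<close>
    have "c ?q * d p \<le> c 1 * d ?q" using cq dq pos dp by (intro mult_mono) auto
    then consider "c 1 * d ?q - c ?q * d p = 0" | "0 < c 1 * d ?q - c ?q * d p" by linarith
    then show ?thesis
    proof cases
      case 1
      then show ?thesis using dq pos c0 by simp
    next
      case 2
      then show ?thesis using tv by (simp only: pos_le_divide_eq)
    qed
  qed
  \<comment> \<open>As \<open>c ?q < c p\<close>, the second fraction of \<open>v_minus\<close> lies
    strictly below \<open>c ?q\<close>, the smallest of the \<open>c i\<close>. This makes all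
    eigenvalues positive.\<close>
  have tq: "t < c ?q"
  proof -
    have "c ?q * c p * (d 1 * d ?q - (d p)\<^sup>2) < c ?q * (c p * d 1 * d ?q - c ?q * (d p)\<^sup>2)"
    proof -
      have "c ?q * (d p)\<^sup>2 < c p * (d p)\<^sup>2" using pos dp by simp
      then have "c p * (d 1 * d ?q - (d p)\<^sup>2) < c p * d 1 * d ?q - c ?q * (d p)\<^sup>2"
        by (simp add: algebra_simps)
      then show ?thesis using c0 by (simp only: mult.assoc mult_less_cancel_left_pos)
    qed
    with t2 have "t * (c p * d 1 * d ?q - c ?q * (d p)\<^sup>2) < c ?q * (c p * d 1 * d ?q - c ?q * (d p)\<^sup>2)"
      by linarith
    then show ?thesis using den2 by (simp only: mult_less_cancel_right_pos)
  qed
  have c_ge: "c ?q \<le> c i" if "i \<in> {1..p}" for i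
  proof (cases "i = p")
    case False
    then show ?thesis using that by (intro c_anti) auto
  qed (use pos in auto)
  have d_pos: "0 < d i" if "i \<in> {1..p}" for i
    using d_anti[of i p] that dp by auto
  have e_pos: "0 < e i" if "i \<in> {1..p}" for i
    unfolding e_def using d_pos[OF that] c_ge[OF that] tq c0 by (intro mult_pos_pos) auto
  have e_mono: "e k \<le> e i" if "1 \<le> i" "i \<le> k" "k \<le> ?q" for i k
  proof -
    have ik: "i \<in> {1..p}" "k \<in> {1..p}" using that by auto
    have "t / c i \<le> t / c k"
      using c_anti[OF that] c_ge[OF ik(2)] c0 t0 by (intro divide_left_mono) (auto intro!: mult_pos_pos)
    moreover have "0 \<le> 1 - t / c k" using c_ge[OF ik(2)] tq c0 by auto
    ultimately show ?thesis
      unfolding e_def using d_anti[of i k] d_pos ik that by (intro mult_mono) (auto simp: less_imp_le)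
  qed
  have 11: "e 1 * d p \<le> d 1 * e ?q"
  proof -
    have "d p * (1 - t / c 1) \<le> d ?q * (1 - t / c ?q)"
      using t1 pos c0 by (simp add: field_simps)
    then have "d 1 * (d p * (1 - t / c 1)) \<le> d 1 * (d ?q * (1 - t / c ?q))"
      using pos by (intro mult_left_mono) auto
    then show ?thesis unfolding e_def by (simp only: mult_ac)
  qed
  have 12: "e 1 * d p \<le> d 1 * e p"
  proof -
    have "t / c p \<le> t / c 1" using cp pos t0 by (intro divide_left_mono) auto
    then have "(d 1 * d p) * (1 - t / c 1) \<le> (d 1 * d p) * (1 - t / c p)"
      using pos dp by (intro mult_left_mono) auto
    then show ?thesis unfolding e_def by (simp only: mult_ac)
  qed
  have 21: "e p * d p \<le> d 1 * e ?q"
    unfolding e_def using t2 pos c0 by (simp add: field_simps power2_eq_square)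
  have 22: "e p * d p \<le> d 1 * e p"
    using e_pos[of p] dq p by (simp add: mult.commute)
  have upper: "e i * d p \<le> d 1 * e k" if i: "i \<in> {1..p}" and k: "k \<in> {?q, p}" for i k
  proof (cases "i = p")
    case True
    then show ?thesis using 21 22 k by auto
  next
    case False
    then have "e i \<le> e 1" using i by (intro e_mono) auto
    then have "e i * d p \<le> e 1 * d p" using dp by simp
    then show ?thesis using 11 12 k by auto
  qed
  have pair: "e i * d p \<le> d 1 * e k" if i: "i \<in> {1..p}" and k: "k \<in> {1..p}" for i k
  proof (cases "k = p")
    case True
    then show ?thesis using upper[OF i, of p] by auto
  next
    case False
    then have "e ?q \<le> e k" using k by (intro e_mono) auto
    then have "d 1 * e ?q \<le> d 1 * e k" using pos by simp
    then show ?thesis using upper[OF i, of ?q] by simp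
  qed
  have ne: "e ` {1..p} \<noteq> {}" using p by auto
  obtain i where i: "i \<in> {1..p}" "Max (e ` {1..p}) = e i"
    using Max_in[OF _ ne] by auto
  obtain k where k: "k \<in> {1..p}" "Min (e ` {1..p}) = e k"
    using Min_in[OF _ ne] by auto
  show "0 < Min ((\<lambda>i. d i * (1 - t / c i)) ` {1..p})"
    using k e_pos by (simp add: e_def[abs_def])
  have "e i / e k \<le> d 1 / d p"
    using pair[OF i(1) k(1)] e_pos[OF k(1)] dp by (simp add: field_simps)
  then show "Max ((\<lambda>i. d i * (1 - t / c i)) ` {1..p}) / Min ((\<lambda>i. d i * (1 - t / c i)) ` {1..p}) \<le> d 1 / d p"
    using i k by (simp add: e_def[abs_def])
qed

section \<open>Minimaxity in the regression model\<close>

definition quad :: "nat \<Rightarrow> nat \<Rightarrow> (nat \<Rightarrow> real) \<Rightarrow> real \<Rightarrow> (nat \<Rightarrow> real) \<times> (nat \<Rightarrow> real) \<Rightarrow> real" where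
  "quad p n d \<sigma> y = ((\<Sum>i=1..p. (fst y i)\<^sup>2 / d i) + (\<Sum>k=1..n. (snd y k)\<^sup>2)) / \<sigma>\<^sup>2"

text \<open>The restriction keeps the centred point extensional, hence in the carrier of the product
  measure.\<close>

definition centre :: "nat \<Rightarrow> (nat \<Rightarrow> real) \<Rightarrow> (nat \<Rightarrow> real) \<times> (nat \<Rightarrow> real) \<Rightarrow> (nat \<Rightarrow> real) \<times> (nat \<Rightarrow> real)" where
  "centre p \<theta> y = (\<lambda>i\<in>{1..p}. fst y i - \<theta> i, snd y)"

text \<open>\<open>f\<close> is only specified, and only measurable, on \<open>[0,\<infinity>)\<close>.\<close>

definition radial_kernel :: "nat \<Rightarrow> nat \<Rightarrow> (nat \<Rightarrow> real) \<Rightarrow> (real \<Rightarrow> real) \<Rightarrow> real \<Rightarrow> real \<Rightarrow> real" where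
  "radial_kernel p n d f \<sigma> s = (\<Prod>i=1..p. d i powr (- 1/2)) * \<sigma> powr (- real p - real n) *
     (if 0 \<le> s then f s else 0)"

lemma quad_nonneg: "\<forall>i\<in>{1..p}. 0 < d i \<Longrightarrow> 0 \<le> quad p n d \<sigma> y"
  unfolding quad_def by (intro divide_nonneg_nonneg add_nonneg_nonneg sum_nonneg) (auto simp: less_imp_le)

lemma joint_density_eq:
  assumes "\<forall>i\<in>{1..p}. 0 < d i"
  shows "joint_density p n d f \<theta> \<sigma> y = radial_kernel p n d f \<sigma> (quad p n d \<sigma> (centre p \<theta> y))"
proof -
  have "quad p n d \<sigma> (centre p \<theta> y) =
      ((\<Sum>i=1..p. (fst y i - \<theta> i)\<^sup>2 / d i) + (\<Sum>k=1..n. (snd y k)\<^sup>2)) / \<sigma>\<^sup>2"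
    unfolding quad_def centre_def by simp
  moreover have "0 \<le> quad p n d \<sigma> (centre p \<theta> y)"
    by (rule quad_nonneg) (rule assms)
  ultimately show ?thesis
    by (simp add: joint_density_def radial_kernel_def case_prod_beta')
qed

lemma measurable_radial_kernel:
  assumes "f \<in> borel_measurable (restrict_space borel {0..})"
  shows "radial_kernel p n d f \<sigma> \<in> borel_measurable borel"
proof -
  have "(\<lambda>s. indicator {0..} s *\<^sub>R f s) \<in> borel_measurable borel"
    using assms by (subst (asm) borel_measurable_restrict_space_iff) auto
  also have "(\<lambda>s. indicator {0..} s *\<^sub>R f s) = (\<lambda>s. if 0 \<le> s then f s else 0)"
    by (auto simp: fun_eq_iff)
  finally show ?thesis unfolding radial_kernel_def[abs_def] by measurable
qed

lemma radial_kernel_nonneg: "(\<And>s. 0 \<le> s \<Longrightarrow> 0 \<le> f s) \<Longrightarrow> 0 \<le> radial_kernel p n d f \<sigma> s"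
  unfolding radial_kernel_def by (intro mult_nonneg_nonneg prod_nonneg) auto

abbreviation sample_space :: "nat \<Rightarrow> nat \<Rightarrow> ((nat \<Rightarrow> real) \<times> (nat \<Rightarrow> real)) measure" where
  "sample_space p n \<equiv> lborel_fun {1..p} \<Otimes>\<^sub>M lborel_fun {1..n}"

lemma measurable_quad[measurable]: "quad p n d \<sigma> \<in> borel_measurable (sample_space p n)"
  unfolding quad_def[abs_def] by measurable

lemma measurable_centre[measurable]: "centre p \<theta> \<in> sample_space p n \<rightarrow>\<^sub>M sample_space p n"
  unfolding centre_def[abs_def] by measurable

lemma estimators_eq: "estimators p n = sample_space p n \<rightarrow>\<^sub>M lborel_fun {1..p}"
  unfolding estimators_def by (intro measurable_cong_sets sets_pair_measure_cong sets_PiM_cong) auto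

text \<open>The factor \<open>1 / \<sigma>^2\<close> moves into the weights, because both the
  location bound and the shrinkage setting work with one fixed scale.\<close>

lemma loss_eq: "loss p d j a \<theta> \<sigma> = (\<Sum>i=1..p. d i powr (- j) / \<sigma>\<^sup>2 * (a i - \<theta> i)\<^sup>2)"
  by (simp add: loss_def sum_divide_distrib)

lemma risk_eq:
  assumes d: "\<forall>i\<in>{1..p}. 0 < d i"
    and f[measurable]: "f \<in> borel_measurable (restrict_space borel {0..})"
    and \<delta>: "\<delta> \<in> estimators p n"
  shows "risk p n d f j \<delta> \<theta> \<sigma> =
    (\<integral>\<^sup>+y. ennreal (\<Sum>i=1..p. d i powr (- j) / \<sigma>\<^sup>2 * (\<delta> y i - \<theta> i)\<^sup>2) *
      ennreal (radial_kernel p n d f \<sigma> (quad p n d \<sigma> (centre p \<theta> y))) \<partial>sample_space p n)"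
proof -
  note measurable_radial_kernel[OF f, measurable]
  have L: "(\<lambda>y. \<Sum>i=1..p. d i powr (- j) / \<sigma>\<^sup>2 * (\<delta> y i - \<theta> i)\<^sup>2)
      \<in> borel_measurable (sample_space p n)"
  proof (intro borel_measurable_sum)
    fix i assume i: "i \<in> {1..p}"
    have [measurable]: "(\<lambda>y. \<delta> y i) \<in> borel_measurable (sample_space p n)"
      using measurable_compose[OF \<delta>[unfolded estimators_eq] measurable_component_singleton[OF i]] by simp
    show "(\<lambda>y. d i powr (- j) / \<sigma>\<^sup>2 * (\<delta> y i - \<theta> i)\<^sup>2) \<in> borel_measurable (sample_space p n)"
      by measurable
  qed
  have F: "(\<lambda>y. ennreal (radial_kernel p n d f \<sigma> (quad p n d \<sigma> (centre p \<theta> y)))) \<in> borel_measurable (sample_space p n)"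
    by measurable
  have G: "(\<lambda>y. ennreal (\<Sum>i=1..p. d i powr (- j) / \<sigma>\<^sup>2 * (\<delta> y i - \<theta> i)\<^sup>2)) \<in> borel_measurable (sample_space p n)"
    by (rule measurable_compose[OF L measurable_ennreal])
  have J: "joint_density p n d f \<theta> \<sigma> y = radial_kernel p n d f \<sigma> (quad p n d \<sigma> (centre p \<theta> y))" for y
    by (rule joint_density_eq[OF d])
  show ?thesis
    unfolding risk_def model_def loss_eq J nn_integral_density[OF F G]
    by (intro nn_integral_cong) (rule mult.commute)
qed

lemma nn_integral_centre:
  assumes G[measurable]: "G \<in> borel_measurable (sample_space p n)"
  shows "(\<integral>\<^sup>+y. G (centre p \<theta> y) \<partial>sample_space p n) = (\<integral>\<^sup>+y. G y \<partial>sample_space p n)"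
proof -
  interpret P: pair_sigma_finite "lborel_fun {1..p}" "lborel_fun {1..n}"
    by (rule pair_sigma_finite_lborel_fun) auto
  have "(\<integral>\<^sup>+y. G (centre p \<theta> y) \<partial>sample_space p n) =
      (\<integral>\<^sup>+z. \<integral>\<^sup>+x. G (centre p \<theta> (x, z)) \<partial>lborel_fun {1..p} \<partial>lborel_fun {1..n})"
    by (rule P.nn_integral_snd[symmetric]) measurable
  also have "\<dots> = (\<integral>\<^sup>+z. \<integral>\<^sup>+x. G (x, z) \<partial>lborel_fun {1..p} \<partial>lborel_fun {1..n})"
  proof (rule nn_integral_cong)
    fix z assume "z \<in> space (lborel_fun {1..n})"
    then have "(\<lambda>x. G (x, z)) \<in> borel_measurable (lborel_fun {1..p})" by measurable
    from nn_integral_lborel_fun_affine[OF _ _ this, of 1 "\<lambda>i. - \<theta> i"]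
    show "(\<integral>\<^sup>+x. G (centre p \<theta> (x, z)) \<partial>lborel_fun {1..p}) = (\<integral>\<^sup>+x. G (x, z) \<partial>lborel_fun {1..p})"
      by (simp add: centre_def)
  qed
  also have "\<dots> = (\<integral>\<^sup>+y. G y \<partial>sample_space p n)"
    by (rule P.nn_integral_snd) measurable
  finally show ?thesis .
qed

lemma fst_in_estimators: "fst \<in> estimators p n"
  unfolding estimators_eq by measurable

text \<open>By translation invariance the risk of \<open>fst\<close> at \<theta> is its risk at 0,
  the quantity in the location bound. Varying only the location at the given \<sigma> suffices,
  since \<open>max_risk\<close> dominates each such risk; the symmetry required of the error density
  is the evenness of \<open>quad\<close>.\<close>

lemma risk_identity_le_max_risk:
  assumes d: "\<forall>i\<in>{1..p}. 0 < d i"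
    and f[measurable]: "f \<in> borel_measurable (restrict_space borel {0..})"
    and \<delta>: "\<delta> \<in> estimators p n" and \<sigma>: "0 < \<sigma>"
  shows "risk p n d f j fst \<theta> \<sigma> \<le> max_risk p n d f j \<delta>"
proof -
  note measurable_radial_kernel[OF f, measurable]
  let ?a = "\<lambda>i. d i powr (- j) / \<sigma>\<^sup>2"
  let ?g = "\<lambda>y. ennreal (radial_kernel p n d f \<sigma> (quad p n d \<sigma> y))"
  have "risk p n d f j fst \<theta> \<sigma> =
      (\<integral>\<^sup>+y. ennreal (\<Sum>i=1..p. ?a i * (fst (centre p \<theta> y) i)\<^sup>2) * ?g (centre p \<theta> y) \<partial>sample_space p n)"
    unfolding risk_eq[OF d f fst_in_estimators]
    by (intro nn_integral_cong arg_cong2[where f = "(*)"] arg_cong[where f = ennreal] sum.cong)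
      (auto simp: centre_def)
  also have "\<dots> = (\<integral>\<^sup>+y. ennreal (\<Sum>i=1..p. ?a i * (fst y i)\<^sup>2) * ?g y \<partial>sample_space p n)"
    by (rule nn_integral_centre) measurable
  also have "\<dots> \<le> max_risk p n d f j \<delta>"
  proof (rule location_minimax_lower_bound[where \<delta> = \<delta>])
    show "finite {1..p}" "finite {1..n}" by simp_all
    show "0 \<le> ?a i" for i by simp
    show "?g \<in> borel_measurable (sample_space p n)" by measurable
    show "?g (\<lambda>i\<in>{1..p}. - e i, z) = ?g (e, z)" for e z by (simp add: quad_def)
    show "(\<lambda>y. \<delta> y i) \<in> borel_measurable (sample_space p n)" if "i \<in> {1..p}" for i
      using measurable_compose[OF \<delta>[unfolded estimators_eq] measurable_component_singleton[OF that]] by simp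
    fix \<theta>' assume \<theta>': "\<theta>' \<in> euclid p"
    have "(\<integral>\<^sup>+y. ennreal (\<Sum>i=1..p. ?a i * (\<delta> y i - \<theta>' i)\<^sup>2) *
        ?g (\<lambda>i\<in>{1..p}. fst y i - \<theta>' i, snd y) \<partial>sample_space p n) = risk p n d f j \<delta> \<theta>' \<sigma>"
      unfolding risk_eq[OF d f \<delta>] centre_def ..
    also have "\<dots> \<le> max_risk p n d f j \<delta>"
      unfolding max_risk_def using \<theta>' \<sigma> by (intro SUP_upper2[of "(\<theta>', \<sigma>)"]) auto
    finally show "(\<integral>\<^sup>+y. ennreal (\<Sum>i=1..p. ?a i * (\<delta> y i - \<theta>' i)\<^sup>2) *
        ?g (\<lambda>i\<in>{1..p}. fst y i - \<theta>' i, snd y) \<partial>sample_space p n) \<le> max_risk p n d f j \<delta>" .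
  qed
  finally show ?thesis .
qed

theorem theorem4p3:
  fixes p n :: nat and d c :: "nat \<Rightarrow> real" and j \<nu> l :: real
    and f \<phi> :: "real \<Rightarrow> real"
  assumes "p \<ge> 3" and "n \<ge> 1"
    and "\<And>i k. 1 \<le> i \<Longrightarrow> i \<le> k \<Longrightarrow> k \<le> p \<Longrightarrow> d k \<le> d i" and "d p > 0"
    and "(\<Sum>i=1..p. (d i / d 1) powr (1 - j)) - 2 \<le> 0"
    and "p \<ge> 4 \<Longrightarrow> 0 \<le> \<nu> \<and> \<nu> < nu_star p d j"
    and "p = 3 \<Longrightarrow> \<nu> = 0"
    and "\<And>i. 1 \<le> i \<Longrightarrow> i \<le> p - 1 \<Longrightarrow> c i = (d i / d (p - 1)) powr (1 - j - \<nu>)"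
    and "c p > c 1"
    and "\<And>s. s \<ge> 0 \<Longrightarrow> f s \<ge> 0"
    and "f \<in> borel_measurable (restrict_space borel {0..})"
    and "\<And>\<theta> \<sigma>. \<theta> \<in> euclid p \<Longrightarrow> \<sigma> > 0 \<Longrightarrow> prob_space (model p n d f \<theta> \<sigma>)"
    and "\<And>\<theta> \<sigma> i. \<theta> \<in> euclid p \<Longrightarrow> \<sigma> > 0 \<Longrightarrow> i \<in> {1..p} \<Longrightarrow>
           integrable (model p n d f \<theta> \<sigma>) (\<lambda>(x, z). (x i)\<^sup>2)"
    and "\<And>w. w > 0 \<Longrightarrow> \<phi> differentiable (at w)"
    and "\<And>w. w > 0 \<Longrightarrow> deriv \<phi> w \<ge> 0"
    and "\<And>w. w > 0 \<Longrightarrow> 0 \<le> \<phi> w / w \<and> \<phi> w / w \<le> v_minus p d c"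
    and "(\<phi> \<longlongrightarrow> l) at_top" and "l \<le> u_minus p n d c j \<nu>"
  shows "minimax p n d f j (theta_hat p n d c \<phi>) \<and> condition_number_decreasing p d c \<phi>"
proof
  note p = assms(1) and anti = assms(3) and dp = assms(4) and sum_le = assms(5)
    and c_eq = assms(8) and cp = assms(9) and f0 = assms(10) and f = assms(11)
  have dpos: "0 < d i" if "i \<in> {1..p}" for i using anti[of i p] dp that by auto
  have d1: "0 < d 1" and dq: "0 < d (p - 1)" using dpos[of 1] dpos[of "p - 1"] p by auto
  \<comment> \<open>Otherwise every summand of the hypothesis on \<open>j\<close> is at least 1, and
    the sum is at least \<open>p \<ge> 3 > 2\<close>.\<close>
  have j1: "0 < 1 - j"
  proof (rule ccontr)
    assume neg: "\<not> 0 < 1 - j"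
    have "real p = (\<Sum>i=1..p. 1)" by simp
    also have "\<dots> \<le> (\<Sum>i=1..p. (d i / d 1) powr (1 - j))"
    proof (rule sum_mono)
      fix i assume i: "i \<in> {1..p}"
      have "(d i / d 1) powr 0 \<le> (d i / d 1) powr (1 - j)"
        using neg i dpos[OF i] d1 anti[of 1 i] by (intro powr_mono') auto
      then show "1 \<le> (d i / d 1) powr (1 - j)" using dpos[OF i] d1 by simp
    qed
    finally show False using sum_le p by linarith
  qed
  \<comment> \<open>For \<open>p \<ge> 4\<close> the upper bound is inherited from
    \<open>nu_star\<close>. It makes the exponent \<open>1 - j - \<nu>\<close> positive, so that
    \<open>c\<close> decreases up to \<open>p - 1\<close>.\<close>
  have \<nu>: "0 \<le> \<nu>" "\<nu> < 1 - j"
  proof -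
    have "0 \<le> \<nu> \<and> \<nu> < 1 - j"
    proof (cases "p = 3")
      case True
      then show ?thesis using assms(7) j1 by simp
    next
      case False
      then have p4: "p \<ge> 4" using p by simp
      have "nu_star p d j < 1 - j"
        using theI'[OF nu_star_ex1[OF p4 anti dp sum_le]] unfolding nu_star_def by blast
      then show ?thesis using assms(6)[OF p4] by simp
    qed
    then show "0 \<le> \<nu>" "\<nu> < 1 - j" by auto
  qed
  have c_anti: "c k \<le> c i" if "1 \<le> i" "i \<le> k" "k \<le> p - 1" for i k
  proof -
    have "(d k / d (p - 1)) powr (1 - j - \<nu>) \<le> (d i / d (p - 1)) powr (1 - j - \<nu>)"
    proof (intro powr_mono2 divide_right_mono)
      have "k \<in> {1..p}" using that by auto
      from dpos[OF this] show "0 \<le> d k / d (p - 1)" using dq by simp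
      show "d k \<le> d i" using that by (intro anti) auto
    qed (use \<nu> dq in auto)
    then show ?thesis using c_eq[of k] c_eq[of i] that by simp
  qed
  have cq: "c (p - 1) = 1" using c_eq[of "p - 1"] p dq by simp
  have cpos: "0 < c i" if i: "i \<in> {1..p}" for i
  proof (cases "i = p")
    case True
    have "c (p - 1) \<le> c 1" using p by (intro c_anti) auto
    then show ?thesis using cq cp True by simp
  next
    case False
    then have "c (p - 1) \<le> c i" using i by (intro c_anti) auto
    then show ?thesis using cq by simp
  qed
  show "condition_number_decreasing p d c \<phi>"
    unfolding condition_number_decreasing_def Let_def
  proof (intro allI impI conjI)
    fix w :: real assume "0 < w"
    from assms(16)[OF this] have t: "0 \<le> \<phi> w / w" "\<phi> w / w \<le> v_minus p d c" by auto
    have "2 \<le> p" "0 < c (p - 1)" using p cq by auto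
    note * = condition_number_le[of p d c "\<phi> w / w", OF this(1) anti dp c_anti this(2) cp t]
    show "0 < Min ((\<lambda>i. d i * (1 - \<phi> w / w / c i)) ` {1..p})"
      "Max ((\<lambda>i. d i * (1 - \<phi> w / w / c i)) ` {1..p}) /
        Min ((\<lambda>i. d i * (1 - \<phi> w / w / c i)) ` {1..p}) \<le> d 1 / d p"
      using * by blast+
  qed
  have der: "(\<phi> has_real_derivative deriv \<phi> w) (at w)" if "0 < w" for w
    using assms(14)[OF that] by (simp add: DERIV_deriv_iff_real_differentiable)
  have \<phi>l: "\<phi> w \<le> l" if w: "0 < w" for w
  proof (rule tendsto_lowerbound[OF assms(17)])
    have "\<phi> w \<le> \<phi> x" if "w \<le> x" for x
      using that w der assms(15) by (intro DERIV_nonneg_imp_nondecreasing[OF that]) (meson less_le_trans)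
    then show "\<forall>\<^sub>F x in at_top. \<phi> w \<le> \<phi> x" by (rule eventually_at_top_linorderI)
  qed simp
  have d': "\<forall>i\<in>{1..p}. 0 < d i" using dpos by blast
  \<comment> \<open>Diagonal entries of D^(1-j) C^(-1). For indices up to \<open>p - 1\<close> the
    exponent chosen for \<open>c\<close> leaves only the power \<nu> of \<open>d i\<close>.\<close>
  define A where "A i = d i powr (- j) * d i / c i" for i
  have A1: "0 < A 1" using d1 cpos[of 1] p by (simp add: A_def)
  have Aeq: "A i = A 1 * (d i / d 1) powr \<nu>" if i: "i \<in> {1..p - 1}" for i
  proof -
    have "A i = d i powr (1 - j) / (d i powr (1 - j - \<nu>) / d (p - 1) powr (1 - j - \<nu>))"
      if "i \<in> {1..p - 1}" for i
    proof -
      have "i \<in> {1..p}" using that by auto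
      then have "0 < d i" by (rule dpos)
      then have "d i powr (- j) * d i = d i powr (1 - j)"
        by (simp add: powr_diff powr_minus field_simps)
      then show ?thesis using c_eq[of i] that \<open>0 < d i\<close> dq by (simp add: A_def powr_divide)
    qed
    moreover have "d i powr (1 - j) / (d i powr (1 - j - \<nu>) / x) = d i powr \<nu> * x"
      if "0 < d i" for i x using that by (simp add: powr_diff)
    ultimately have "A i = d i powr \<nu> * d (p - 1) powr (1 - j - \<nu>)" if "i \<in> {1..p - 1}" for i
      using that dpos[of i] by auto
    from this[OF i] this[of 1] show ?thesis using p d1 dpos[of i] i by (simp add: powr_divide)
  qed
  have Ap: "A p = A 1 * (c 1 / c p * (d p / d 1) powr (1 - j))"
  proof -
    have "d i powr (- j) * d i = d i powr (1 - j)" if "0 < d i" for i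
      using that by (simp add: powr_diff powr_minus field_simps)
    then show ?thesis
      using dp d1 cpos[of 1] cpos[of p] p by (simp add: A_def powr_divide)
  qed
  have split: "{1..p} = insert p {1..p - 1}" using p by auto
  have sumA: "(\<Sum>i=1..p. A i) =
      A 1 * ((\<Sum>i=1..p-1. (d i / d 1) powr \<nu>) + c 1 / c p * (d p / d 1) powr (1 - j))"
  proof -
    have "(\<Sum>i=1..p. A i) = A p + (\<Sum>i=1..p-1. A i)"
      unfolding split using p by (subst sum.insert) auto
    also have "(\<Sum>i=1..p-1. A i) = A 1 * (\<Sum>i=1..p-1. (d i / d 1) powr \<nu>)"
      unfolding sum_distrib_left by (rule sum.cong[OF refl]) (rule Aeq)
    finally show ?thesis by (simp add: Ap distrib_left)
  qed
  \<comment> \<open>Ratios \<open>d i / d 1\<close> are at most 1 and the exponents \<nu> and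
    \<open>1 - j\<close> are nonnegative; at \<open>p\<close> the factor
    \<open>c 1 / c p < 1\<close> helps as well.\<close>
  have A_le: "A i \<le> A 1" if i: "i \<in> {1..p}" for i
  proof -
    have r: "0 \<le> d i / d 1" "d i / d 1 \<le> 1" using dpos[OF i] d1 anti[of 1 i] i by auto
    show ?thesis
    proof (cases "i = p")
      case True
      have "c 1 / c p * (d p / d 1) powr (1 - j) \<le> 1 * 1"
        using r cp cpos[of 1] cpos[of p] p j1 True by (intro mult_mono powr_le1) auto
      then have "A 1 * (c 1 / c p * (d p / d 1) powr (1 - j)) \<le> A 1 * 1"
        using A1 by (intro mult_left_mono) auto
      then show ?thesis using Ap True by simp
    next
      case False
      then have "A i = A 1 * (d i / d 1) powr \<nu>" using i by (intro Aeq) auto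
      also have "\<dots> \<le> A 1 * 1" using A1 r \<nu> by (intro mult_left_mono powr_le1) auto
      finally show ?thesis by simp
    qed
  qed
  have lA: "(real n + 2) * l * A 1 \<le> 2 * (\<Sum>i=1..p. A i) - 4 * A 1"
  proof -
    have "(real n + 2) * l \<le> (real n + 2) * u_minus p n d c j \<nu>"
      using assms(18) by (intro mult_left_mono) auto
    also have "\<dots> = 2 * ((\<Sum>i=1..p-1. (d i / d 1) powr \<nu>) - 2 + c 1 / c p * (d p / d 1) powr (1 - j))"
      by (simp add: u_minus_def)
    finally have "(real n + 2) * l * A 1 \<le>
        2 * ((\<Sum>i=1..p-1. (d i / d 1) powr \<nu>) - 2 + c 1 / c p * (d p / d 1) powr (1 - j)) * A 1"
      using A1 by (intro mult_right_mono) auto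
    then show ?thesis unfolding sumA by (simp add: algebra_simps)
  qed
  have shrinkage: "shrinkage {1..p} {1..n} (\<lambda>i. d i powr (- j) / \<sigma>\<^sup>2) c d \<phi> (deriv \<phi>)
      (v_minus p d c) l (A 1 / \<sigma>\<^sup>2)" if \<sigma>: "0 < \<sigma>" for \<sigma>
  proof
    show "0 \<le> \<phi> w" if "0 < w" for w
      using assms(16)[OF that] that by (simp add: zero_le_divide_iff)
    show "d i powr - j / \<sigma>\<^sup>2 * d i / c i \<le> A 1 / \<sigma>\<^sup>2" if "i \<in> {1..p}" for i
      using divide_right_mono[OF A_le[OF that], of "\<sigma>\<^sup>2"] by (simp add: A_def mult_ac)
    show "(real (card {1..n}) + 2) * l * (A 1 / \<sigma>\<^sup>2) \<le>
        2 * (\<Sum>i=1..p. d i powr - j / \<sigma>\<^sup>2 * d i / c i) - 4 * (A 1 / \<sigma>\<^sup>2)"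
    proof -
      have "(\<Sum>i=1..p. d i powr - j / \<sigma>\<^sup>2 * d i / c i) = (\<Sum>i=1..p. A i) / \<sigma>\<^sup>2"
        by (simp add: A_def sum_divide_distrib mult_ac)
      then show ?thesis
        using divide_right_mono[OF lA, of "\<sigma>\<^sup>2"] by (simp add: diff_divide_distrib)
    qed
  qed (use p dpos cpos der assms(15,16) \<phi>l in auto)
  \<comment> \<open>\<open>est\<close> and \<open>W\<close> do not involve the loss weights, so the
    instance at scale 1 describes the estimator for every \<sigma>.\<close>
  interpret shrinkage "{1..p}" "{1..n}" "\<lambda>i. d i powr (- j) / 1\<^sup>2" c d \<phi> "deriv \<phi>" "v_minus p d c" l "A 1 / 1\<^sup>2"
    by (rule shrinkage) simp
  have est: "theta_hat p n d c \<phi> y = (\<lambda>i\<in>{1..p}. est y i)" for y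
  proof -
    have "W_stat p n d c y = W y"
      unfolding W_stat_def W_def q_def S_def by (simp add: case_prod_beta')
    moreover have "\<rho> (W y) = \<phi> (W y) / W y"
    proof -
      have "0 \<le> W y" unfolding W_def using q0 S0 by (rule divide_nonneg_nonneg)
      then show ?thesis unfolding \<rho>_def \<Phi>_def by auto
    qed
    ultimately show ?thesis
      unfolding est_def by (simp add: theta_hat_def case_prod_beta' fun_eq_iff restrict_def)
  qed
  have est_in: "theta_hat p n d c \<phi> \<in> estimators p n"
    unfolding estimators_eq est[abs_def] by (rule measurable_restrict) (use measurable_est in simp)
  have dom: "risk p n d f j (theta_hat p n d c \<phi>) \<theta> \<sigma> \<le> risk p n d f j fst \<theta> \<sigma>"
    if \<theta>: "\<theta> \<in> euclid p" and \<sigma>: "0 < \<sigma>" for \<theta> \<sigma>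
  proof -
    note measurable_radial_kernel[OF f, measurable]
    interpret s: shrinkage "{1..p}" "{1..n}" "\<lambda>i. d i powr (- j) / \<sigma>\<^sup>2" c d \<phi> "deriv \<phi>" "v_minus p d c" l "A 1 / \<sigma>\<^sup>2"
      by (rule shrinkage[OF \<sigma>])
    have Q: "s.Q \<theta> \<sigma> y = quad p n d \<sigma> (centre p \<theta> y)" for y
      unfolding s.Q_def s.S_def by (simp add: quad_def centre_def)
    interpret prob_space "model p n d f \<theta> \<sigma>" by (rule assms(12)[OF \<theta> \<sigma>])
    have J: "joint_density p n d f \<theta> \<sigma> y = radial_kernel p n d f \<sigma> (quad p n d \<sigma> (centre p \<theta> y))" for y
      by (rule joint_density_eq[OF d'])
    have F: "(\<lambda>y. ennreal (radial_kernel p n d f \<sigma> (quad p n d \<sigma> (centre p \<theta> y))))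
        \<in> borel_measurable (sample_space p n)"
      by measurable
    \<comment> \<open>The integral of the kernel is the total mass 1 of the model, which gives the
      finiteness required for the risk comparison.\<close>
    have "(\<integral>\<^sup>+y. ennreal (radial_kernel p n d f \<sigma> (quad p n d \<sigma> (centre p \<theta> y))) \<partial>sample_space p n) =
        emeasure (model p n d f \<theta> \<sigma>) (space (model p n d f \<theta> \<sigma>))"
      unfolding model_def J
      by (subst emeasure_density[OF F]) (auto intro!: nn_integral_cong)
    then have "(\<integral>\<^sup>+y. ennreal (radial_kernel p n d f \<sigma> (s.Q \<theta> \<sigma> y)) \<partial>sample_space p n) < \<infinity>"
      unfolding Q emeasure_space_1 by simp
    from s.risk_le[OF \<sigma> measurable_radial_kernel[OF f] radial_kernel_nonneg[OF f0] this]
    show ?thesis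
      unfolding risk_eq[OF d' f est_in] risk_eq[OF d' f fst_in_estimators] Q by (simp add: est)
  qed
  show "minimax p n d f j (theta_hat p n d c \<phi>)"
    unfolding minimax_def
  proof (intro conjI ballI est_in)
    fix \<delta> assume \<delta>: "\<delta> \<in> estimators p n"
    show "max_risk p n d f j (theta_hat p n d c \<phi>) \<le> max_risk p n d f j \<delta>"
      unfolding max_risk_def[of _ _ _ _ _ "theta_hat p n d c \<phi>"]
    proof (rule SUP_least)
      fix x assume "x \<in> euclid p \<times> {0 :: real<..}"
      then obtain \<theta> \<sigma> where x: "x = (\<theta>, \<sigma>)" and \<theta>: "\<theta> \<in> euclid p" and \<sigma>: "0 < \<sigma>" by blast
      from dom[OF \<theta> \<sigma>] risk_identity_le_max_risk[OF d' f \<delta> \<sigma>]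
      have "risk p n d f j (theta_hat p n d c \<phi>) \<theta> \<sigma> \<le> max_risk p n d f j \<delta>"
        by (rule order_trans)
      then show "(case x of (\<theta>, \<sigma>) \<Rightarrow> risk p n d f j (theta_hat p n d c \<phi>) \<theta> \<sigma>) \<le> max_risk p n d f j \<delta>"
        by (simp add: x)
    qed
  qed
qed

end
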